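(* Let $p$ be a prime and let $A\subseteq\mathcal{B}_{(1)}(\mathbb{Q}_p(\mathbb{N}))$ be a norm-closed subalgebra containing $\mathcal{K}_{(1)}(\mathbb{Q}_p(\mathbb{N}))$. If $E$ is an idempotent element of the quotient algebra $A/\mathcal{K}_{(1)}(\mathbb{Q}_p(\mathbb{N}))$, then there exists $e\in A$ with $e^2=e$ and $e+\mathcal{K}_{(1)}(\mathbb{Q}_p(\mathbb{N}))=E$.
   Context: $\mathbb{Q}_p(\mathbb{N})$ is the set of maps $\xi:\mathbb{N}\to\mathbb{Q}_p$ with $|\xi(i)|_p\le 1$ for all but finitely many $i$, a $\mathbb{Z}_p$-module under coordinatewise operations, with the topology $\tau$ in which $A\subseteq\mathbb{Q}_p(\mathbb{N})$ is open iff for every finite $P\subseteq\mathbb{N}$ the set $A\cap\big(\prod_{i\in P}\mathbb{Q}_p\times\prod_{j\notin P}\mathbb{Z}_p\big)$ is open in the product topology. $\mathcal{B}(\mathbb{Q}_p(\mathbb{N}))$ is the algebra of $\tau$-continuous $\mathbb{Z}_p$-linear maps on $\mathbb{Q}_p(\mathbb{N})$. Norm: $\|\xi\|=\max_i|\xi(i)|_p$; operator norm $\|T\|=\sup_{\|\xi\|\le1}\|T\xi\|$. $\mathcal{B}_{(1)}(\mathbb{Q}_p(\mathbb{N}))$ is the set of operators of norm at most $1$. $\mathcal{K}(\mathbb{Q}_p(\mathbb{N}))$ is the set of operators in $\mathcal{B}(\mathbb{Q}_p(\mathbb{N}))$ mapping norm-bounded sets onto relatively $\tau$-compact sets, and $\mathcal{K}_{(1)}(\mathbb{Q}_p(\mathbb{N}))$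 those of norm at most $1$. *)

theory Defs
  imports "HOL-Analysis.Analysis" "HOL-Computational_Algebra.Computational_Algebra"
begin

definition padic_val :: "nat \<Rightarrow> rat \<Rightarrow> int" where
  "padic_val p q = int (multiplicity (int p) (fst (quotient_of q)))
                 - int (multiplicity (int p) (snd (quotient_of q)))"

definition padic_abs :: "nat \<Rightarrow> rat \<Rightarrow> real" where
  "padic_abs p q = (if q = 0 then 0 else real p powr (- real_of_int (padic_val p q)))"

definition padic_cauchy :: "nat \<Rightarrow> (nat \<Rightarrow> rat) \<Rightarrow> bool" where
  "padic_cauchy p f \<longleftrightarrow> (\<forall>e>0. \<exists>N. \<forall>m\<ge>N. \<forall>n\<ge>N. padic_abs p (f m - f n) < e)"

text \<open>An element of Q_p is an equivalence class of p-adically Cauchy sequences of rationals.\<close>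
type_synonym qp = "(nat \<Rightarrow> rat) set"

definition qp_class :: "nat \<Rightarrow> (nat \<Rightarrow> rat) \<Rightarrow> qp" where
  "qp_class p f = {g. padic_cauchy p g \<and> (\<lambda>n. padic_abs p (f n - g n)) \<longlonglongrightarrow> 0}"

definition Qp :: "nat \<Rightarrow> qp set" where
  "Qp p = {qp_class p f | f. padic_cauchy p f}"

definition qp_rep :: "qp \<Rightarrow> (nat \<Rightarrow> rat)" where
  "qp_rep X = (SOME f. f \<in> X)"

definition qp_add :: "nat \<Rightarrow> qp \<Rightarrow> qp \<Rightarrow> qp" where
  "qp_add p X Y = qp_class p (\<lambda>n. qp_rep X n + qp_rep Y n)"

definition qp_neg :: "nat \<Rightarrow> qp \<Rightarrow> qp" where
  "qp_neg p X = qp_class p (\<lambda>n. - qp_rep X n)"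

definition qp_mult :: "nat \<Rightarrow> qp \<Rightarrow> qp \<Rightarrow> qp" where
  "qp_mult p X Y = qp_class p (\<lambda>n. qp_rep X n * qp_rep Y n)"

definition qp_abs :: "nat \<Rightarrow> qp \<Rightarrow> real" where
  "qp_abs p X = lim (\<lambda>n. padic_abs p (qp_rep X n))"

definition qp_dist :: "nat \<Rightarrow> qp \<Rightarrow> qp \<Rightarrow> real" where
  "qp_dist p X Y = qp_abs p (qp_add p X (qp_neg p Y))"

definition Zp :: "nat \<Rightarrow> qp set" where
  "Zp p = {a \<in> Qp p. qp_abs p a \<le> 1}"

definition qp_top :: "nat \<Rightarrow> qp topology" where
  "qp_top p = topology (\<lambda>U. U \<subseteq> Qp p \<and>
      (\<forall>x\<in>U. \<exists>e>0. \<forall>y\<in>Qp p. qp_dist p x y < e \<longrightarrow> y \<in> U))"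

type_synonym qpN = "nat \<Rightarrow> qp"

definition QpN :: "nat \<Rightarrow> qpN set" where
  "QpN p = {\<xi>. (\<forall>i. \<xi> i \<in> Qp p) \<and> finite {i. qp_abs p (\<xi> i) > 1}}"

definition vadd :: "nat \<Rightarrow> qpN \<Rightarrow> qpN \<Rightarrow> qpN" where
  "vadd p \<xi> \<eta> = (\<lambda>i. qp_add p (\<xi> i) (\<eta> i))"

definition vneg :: "nat \<Rightarrow> qpN \<Rightarrow> qpN" where
  "vneg p \<xi> = (\<lambda>i. qp_neg p (\<xi> i))"

definition vsmul :: "nat \<Rightarrow> qp \<Rightarrow> qpN \<Rightarrow> qpN" where
  "vsmul p a \<xi> = (\<lambda>i. qp_mult p a (\<xi> i))"

text \<open>Norm: max_i |xi(i)|_p (the supremum is attained).\<close>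
definition vnorm :: "nat \<Rightarrow> qpN \<Rightarrow> real" where
  "vnorm p \<xi> = (SUP i. qp_abs p (\<xi> i))"

definition XP :: "nat \<Rightarrow> nat set \<Rightarrow> qpN set" where
  "XP p P = {\<xi> \<in> QpN p. \<forall>j. j \<notin> P \<longrightarrow> \<xi> j \<in> Zp p}"

definition prod_top :: "nat \<Rightarrow> qpN topology" where
  "prod_top p = product_topology (\<lambda>i. qp_top p) UNIV"

definition tau :: "nat \<Rightarrow> qpN topology" where
  "tau p = topology (\<lambda>A. A \<subseteq> QpN p \<and>
      (\<forall>P. finite P \<longrightarrow> openin (subtopology (prod_top p) (XP p P)) (A \<inter> XP p P)))"

definition Bop :: "nat \<Rightarrow> (qpN \<Rightarrow> qpN) set" where
  "Bop p = {T. T \<in> QpN p \<rightarrow> QpN p \<and> T \<in> extensional (QpN p) \<and>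
     (\<forall>\<xi>\<in>QpN p. \<forall>\<eta>\<in>QpN p. T (vadd p \<xi> \<eta>) = vadd p (T \<xi>) (T \<eta>)) \<and>
     (\<forall>a\<in>Zp p. \<forall>\<xi>\<in>QpN p. T (vsmul p a \<xi>) = vsmul p a (T \<xi>)) \<and>
     continuous_map (tau p) (tau p) T}"

definition op_norm :: "nat \<Rightarrow> (qpN \<Rightarrow> qpN) \<Rightarrow> real" where
  "op_norm p T = (SUP \<xi>\<in>{\<xi> \<in> QpN p. vnorm p \<xi> \<le> 1}. vnorm p (T \<xi>))"

definition B1 :: "nat \<Rightarrow> (qpN \<Rightarrow> qpN) set" where
  "B1 p = {T \<in> Bop p. \<forall>\<xi>\<in>QpN p. vnorm p \<xi> \<le> 1 \<longrightarrow> vnorm p (T \<xi>) \<le> 1}"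

definition Kop :: "nat \<Rightarrow> (qpN \<Rightarrow> qpN) set" where
  "Kop p = {T \<in> Bop p. \<forall>B. B \<subseteq> QpN p \<longrightarrow> (\<exists>r. \<forall>\<xi>\<in>B. vnorm p \<xi> \<le> r) \<longrightarrow>
      compactin (tau p) ((tau p) closure_of (T ` B))}"

definition K1 :: "nat \<Rightarrow> (qpN \<Rightarrow> qpN) set" where
  "K1 p = Kop p \<inter> B1 p"

definition op_add :: "nat \<Rightarrow> (qpN \<Rightarrow> qpN) \<Rightarrow> (qpN \<Rightarrow> qpN) \<Rightarrow> (qpN \<Rightarrow> qpN)" where
  "op_add p T S = restrict (\<lambda>\<xi>. vadd p (T \<xi>) (S \<xi>)) (QpN p)"

definition op_neg :: "nat \<Rightarrow> (qpN \<Rightarrow> qpN) \<Rightarrow> (qpN \<Rightarrow> qpN)" where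
  "op_neg p T = restrict (\<lambda>\<xi>. vneg p (T \<xi>)) (QpN p)"

definition op_smul :: "nat \<Rightarrow> qp \<Rightarrow> (qpN \<Rightarrow> qpN) \<Rightarrow> (qpN \<Rightarrow> qpN)" where
  "op_smul p a T = restrict (\<lambda>\<xi>. vsmul p a (T \<xi>)) (QpN p)"

definition op_comp :: "nat \<Rightarrow> (qpN \<Rightarrow> qpN) \<Rightarrow> (qpN \<Rightarrow> qpN) \<Rightarrow> (qpN \<Rightarrow> qpN)" where
  "op_comp p T S = compose (QpN p) T S"

definition norm_closed_subalgebra :: "nat \<Rightarrow> (qpN \<Rightarrow> qpN) set \<Rightarrow> bool" where
  "norm_closed_subalgebra p A \<longleftrightarrow> A \<subseteq> B1 p \<and> A \<noteq> {} \<and>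
     (\<forall>T\<in>A. \<forall>S\<in>A. op_add p T S \<in> A) \<and>
     (\<forall>T\<in>A. op_neg p T \<in> A) \<and>
     (\<forall>a\<in>Zp p. \<forall>T\<in>A. op_smul p a T \<in> A) \<and>
     (\<forall>T\<in>A. \<forall>S\<in>A. op_comp p T S \<in> A) \<and>
     (\<forall>T\<in>B1 p. \<forall>Tn. (\<forall>n. Tn n \<in> A) \<and>
        (\<lambda>n. op_norm p (op_add p (Tn n) (op_neg p T))) \<longlonglongrightarrow> 0 \<longrightarrow> T \<in> A)"

definition op_coset :: "nat \<Rightarrow> (qpN \<Rightarrow> qpN) \<Rightarrow> (qpN \<Rightarrow> qpN) set \<Rightarrow> (qpN \<Rightarrow> qpN) set" where
  "op_coset p T K = {op_add p T k | k. k \<in> K}"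

end

theory Submission
  imports Defs
begin

text \<open>
Write \<open>Z\<close> for the unit ball of \<open>\<rat>\<^sub>p(\<nat>)\<close> and \<open>B\<^sub>n\<close> for the ball of radius \<open>p\<^sup>n\<close>. Since \<open>Z\<close> is a compact open
subgroup, an operator \<open>k\<close> is compact iff each \<open>k(B\<^sub>n)\<close> meets only finitely many cosets of \<open>Z\<close>.
Let \<open>a\<^sup>2 = a + k\<close> with \<open>k\<close> compact. Then \<open>a\<^sup>j - a = k c\<^sub>j = c\<^sub>j k\<close> with \<open>c\<^sub>j\<close> a contraction, so on \<open>B\<^sub>n\<close> and
modulo \<open>Z\<close> there are only finitely many possibilities for \<open>a\<^sup>j\<close>: the powers of \<open>a\<close> form a finite
semigroup modulo \<open>p\<^sup>n\<close>. Hence some \<open>a\<^sup>M\<close> is idempotent modulo \<open>p\<^sup>n\<close> and congruent to all its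
powers. If \<open>M\<^sub>n\<close> denotes such an exponent and \<open>N\<^sub>n = M\<^sub>0 \<dots> M\<^sub>n\<close>, then the powers of \<open>a\<close> with
exponents \<open>N\<^sub>n\<close> converge in norm to an idempotent \<open>e\<close>, and \<open>e - a\<close> is compact because on \<open>B\<^sub>n\<close> its values
agree modulo \<open>Z\<close> with values of \<open>k\<close>.
\<close>

section \<open>The p-adic absolute value\<close>

text \<open>The usual polynomials that lift idempotents modulo a nil ideal are of no use:
  \<open>k\<close> need be neither nilpotent nor small in norm. Finiteness replaces smallness. By
  induction a^(j+1) = a + k (1 + a + ... + a^(j-1)). Read one way, the difference from
  \<open>a\<close> takes values in the range of \<open>k\<close>; read the other way, it lies in the
  unit ball wherever \<open>k\<close> does. So modulo the unit ball it is described by a map between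
  finite sets of classes, and two powers must agree. The obstacle is the passage from a congruence
  modulo Z on the ball B_n to an estimate by p^-n on Z. The space is not closed under division by p:
  the constant sequence 1/p does not belong to it. A vector of Z therefore cannot simply be
  multiplied by p^-n; it is first truncated to finite support, and continuity for \<open>tau\<close>
  takes care of the tail. The exponents N_n play the role of n! in the description of the idempotent
  of a profinite monogenic semigroup as the limit of a^(n!): each M_m divides all N_n with n >= m,
  so all later powers agree modulo p^m.\<close>

locale padic =
  fixes p :: nat
  assumes prime_p: "prime p"
begin

lemma p_gt_1: "real p > 1"
  using prime_gt_1_nat[OF prime_p] by simp

lemma p_pos: "real p > 0"
  using p_gt_1 by simp

lemma prime_elem_p: "prime_elem (int p)"
  using prime_p by (simp add: prime_imp_prime_elem)

text \<open>The definition reads the reduced fraction. Cross-multiplication shows that any fraction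
  gives the same value, so products and sums can be treated without reducing them.\<close>

lemma padic_val_fract:
  assumes "a \<noteq> 0" "b \<noteq> 0"
  shows "padic_val p (of_int a / of_int b) = int (multiplicity (int p) a) - int (multiplicity (int p) b)"
proof -
  let ?q = "of_int a / of_int b :: rat"
  obtain c d where q: "quotient_of ?q = (c, d)" by fastforce
  have d: "d > 0" using quotient_of_denom_pos[OF q] .
  have "?q = of_int c / of_int d" using quotient_of_div[OF q] .
  then have "of_int (a * d) = (of_int (c * b) :: rat)" using assms d by (simp add: field_simps)
  then have e: "a * d = c * b" by (simp only: of_int_eq_iff)
  then have c: "c \<noteq> 0" using assms d by auto
  have "multiplicity (int p) a + multiplicity (int p) d = multiplicity (int p) c + multiplicity (int p) b"
    using prime_elem_multiplicity_mult_distrib[OF prime_elem_p] assms c d e by (metis less_irrefl)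
  then show ?thesis unfolding padic_val_def q by simp
qed

lemma rat_fract_cases:
  fixes q :: rat
  obtains a b where "q = of_int a / of_int b" "b \<noteq> 0"
  by (metis less_irrefl quotient_of_denom_pos quotient_of_div prod.exhaust)

lemma padic_abs_fract:
  assumes "a \<noteq> 0" "b \<noteq> 0"
  shows "padic_abs p (of_int a / of_int b)
    = real p powr (real (multiplicity (int p) b) - real (multiplicity (int p) a))"
  using assms by (simp add: padic_abs_def padic_val_fract)

lemma padic_abs_0 [simp]: "padic_abs p 0 = 0"
  by (simp add: padic_abs_def)

lemma padic_abs_nonneg [simp]: "padic_abs p x \<ge> 0"
  by (simp add: padic_abs_def)

lemma padic_abs_minus [simp]: "padic_abs p (- x) = padic_abs p x"
proof (cases "x = 0")
  case False
  obtain a b where x: "x = of_int a / of_int b" "b \<noteq> 0" by (rule rat_fract_cases)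
  have m: "- x = of_int (- a) / of_int b" using x by simp
  show ?thesis using False x unfolding m unfolding x(1)
    by (subst (1 2) padic_abs_fract) auto
qed simp

lemma padic_abs_diff_commute: "padic_abs p (x - y) = padic_abs p (y - x)"
  by (metis minus_diff_eq padic_abs_minus)

lemma padic_abs_mult: "padic_abs p (x * y) = padic_abs p x * padic_abs p y"
proof (cases "x = 0 \<or> y = 0")
  case False
  obtain a b where x: "x = of_int a / of_int b" "b \<noteq> 0" by (rule rat_fract_cases)
  obtain c d where y: "y = of_int c / of_int d" "d \<noteq> 0" by (rule rat_fract_cases)
  have nz: "a \<noteq> 0" "c \<noteq> 0" using False x y by auto
  have xy: "x * y = of_int (a * c) / of_int (b * d)" using x y by simp
  show ?thesis
    unfolding xy unfolding x(1) y(1) using nz x y p_pos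
    by (subst (1 2 3) padic_abs_fract)
       (auto simp: prime_elem_multiplicity_mult_distrib[OF prime_elem_p] algebra_simps simp flip: powr_add)
qed auto

lemma padic_abs_add: "padic_abs p (x + y) \<le> max (padic_abs p x) (padic_abs p y)"
proof (cases "x = 0 \<or> y = 0 \<or> x + y = 0")
  case False
  obtain a b where x: "x = of_int a / of_int b" "b \<noteq> 0" by (rule rat_fract_cases)
  obtain c d where y: "y = of_int c / of_int d" "d \<noteq> 0" by (rule rat_fract_cases)
  have x': "x = of_int (a * d) / of_int (b * d)" and y': "y = of_int (c * b) / of_int (b * d)"
    and s: "x + y = of_int (a * d + c * b) / of_int (b * d)"
    using x y by (auto simp: field_simps)
  have nz: "a * d \<noteq> 0" "c * b \<noteq> 0" "b * d \<noteq> 0" "a * d + c * b \<noteq> 0"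
    using False x y x' y' s by (force simp del: of_int_mult of_int_add)+
  \<comment> \<open>Over a common denominator the ultrametric inequality becomes divisibility: the
    smaller power of p divides both numerators, hence their sum.\<close>
  let ?m = "min (multiplicity (int p) (a * d)) (multiplicity (int p) (c * b))"
  have "int p ^ ?m dvd a * d + c * b"
    by (intro dvd_add multiplicity_dvd') auto
  then have "?m \<le> multiplicity (int p) (a * d + c * b)"
    using nz p_gt_1 prime_elem_p prime_elem_not_unit multiplicity_geI by blast
  then show ?thesis
    unfolding s unfolding x' y' using nz p_gt_1
    by (subst (1 2 3) padic_abs_fract) (auto simp: le_max_iff_disj min_le_iff_disj powr_mono)
qed (auto simp: le_max_iff_disj)

lemma padic_abs_triangle: "padic_abs p (x - z) \<le> max (padic_abs p (x - y)) (padic_abs p (y - z))"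
  using padic_abs_add[of "x - y" "y - z"] by simp

lemma padic_abs_int_le_1: "padic_abs p (of_int z) \<le> 1"
  using padic_abs_fract[of z 1] p_gt_1 powr_mono[of "- real (multiplicity (int p) z)" 0 "real p"]
  by (cases "z = 0") auto

lemma padic_abs_1 [simp]: "padic_abs p 1 = 1"
  using padic_abs_fract[of 1 1] p_pos by simp

lemma padic_abs_p: "padic_abs p (of_nat p) = 1 / real p"
proof -
  have "multiplicity (int p) (int p) = 1"
    using prime_elem_p by (simp add: multiplicity_self prime_elem_def)
  then show ?thesis using padic_abs_fract[of "int p" 1] p_pos
    by (simp add: powr_minus divide_inverse)
qed

lemma padic_abs_power: "padic_abs p (x ^ n) = padic_abs p x ^ n"
  by (induction n) (auto simp: padic_abs_mult)

lemma padic_abs_inverse: "padic_abs p (inverse x) = inverse (padic_abs p x)"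
proof (cases "x = 0")
  case False
  then have "padic_abs p x * padic_abs p (inverse x) = 1" by (simp flip: padic_abs_mult)
  then show ?thesis by (metis inverse_unique)
qed simp

lemma padic_abs_p_power: "padic_abs p (of_nat p ^ n) = 1 / real p ^ n"
  by (simp add: padic_abs_power padic_abs_p power_divide)

lemma padic_abs_int_dvd:
  assumes "int p ^ n dvd z"
  shows "padic_abs p (of_int z) \<le> 1 / real p ^ n"
proof -
  obtain w where w: "z = int p ^ n * w" using assms by blast
  have "padic_abs p (of_int z) = 1 / real p ^ n * padic_abs p (of_int w)"
    by (simp add: w padic_abs_mult padic_abs_p_power)
  also have "\<dots> \<le> 1 / real p ^ n * 1"
    by (intro mult_left_mono padic_abs_int_le_1) auto
  finally show ?thesis by simp
qed

text \<open>For x = a/b in lowest terms the denominator is prime to p, so Bezout's identity inverts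
  b modulo p^n, and z is the residue of a times this inverse. The finite range of z later provides
  finite nets in Z_p.\<close>

lemma padic_abs_int_approx:
  assumes "padic_abs p x \<le> 1"
  shows "\<exists>z\<in>{0..<int p ^ n}. padic_abs p (x - of_int z) \<le> 1 / real p ^ n"
proof -
  obtain a b where q: "quotient_of x = (a, b)" by fastforce
  have b: "b > 0" using quotient_of_denom_pos[OF q] .
  have x: "x = of_int a / of_int b" using quotient_of_div[OF q] .
  have cop: "coprime a b" using quotient_of_coprime[OF q] .
  have pb: "\<not> int p dvd b"
  proof
    assume d: "int p dvd b"
    then have "\<not> int p dvd a"
      using cop prime_elem_p by (meson coprime_common_divisor prime_elem_def)
    then have a: "a \<noteq> 0" "multiplicity (int p) a = 0" by (auto intro: not_dvd_imp_multiplicity_0)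
    have "multiplicity (int p) b > 0"
      using d b prime_elem_p prime_elem_multiplicity_eq_zero_iff[of "int p" b] by auto
    then have "real p powr (real (multiplicity (int p) b) - real (multiplicity (int p) a)) > 1"
      using a p_gt_1 by (simp add: powr_realpow)
    then show False using assms padic_abs_fract[of a b] a b x by simp
  qed
  then have "coprime (int p ^ n) b"
    using prime_p by (simp add: prime_imp_coprime)
  then obtain u v where uv: "u * int p ^ n + v * b = 1"
    using bezout_int coprime_imp_gcd_eq_1 by metis
  define z where "z = (a * v) mod int p ^ n"
  have z: "z \<in> {0..<int p ^ n}" using p_pos by (simp add: z_def)
  have "int p ^ n dvd a - b * z"
  proof -
    have "int p ^ n dvd a * v - z" unfolding z_def by (simp add: minus_mod_eq_mult_div)
    moreover have "a - b * z = (a * u) * int p ^ n + b * (a * v - z)"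
    proof -
      have "a = a * (u * int p ^ n + v * b)" using uv by simp
      then show ?thesis by (simp add: algebra_simps)
    qed
    ultimately show ?thesis by (metis dvd_add dvd_mult dvd_triv_right)
  qed
  then have "padic_abs p (of_int (a - b * z)) \<le> 1 / real p ^ n" by (rule padic_abs_int_dvd)
  moreover have "padic_abs p (of_int b) = 1"
    using padic_abs_fract[of b 1] b pb p_pos by (simp add: not_dvd_imp_multiplicity_0)
  moreover have "of_int (a - b * z) = (x - of_int z) * of_int b"
    using b x by (simp add: field_simps)
  ultimately show ?thesis using z by (metis padic_abs_mult mult.right_neutral)
qed

end

section \<open>The field of p-adic numbers\<close>

context padic
begin

section \<open>Cauchy sequences of rationals\<close>

lemma abs_padic_abs_diff_le: "\<bar>padic_abs p x - padic_abs p y\<bar> \<le> padic_abs p (x - y)"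
proof -
  have "padic_abs p u \<le> padic_abs p (u - v) + padic_abs p v" for u v
  proof -
    have "padic_abs p u \<le> max (padic_abs p (u - v)) (padic_abs p v)"
      using padic_abs_add[of "u - v" v] by simp
    also have "\<dots> \<le> padic_abs p (u - v) + padic_abs p v" by simp
    finally show ?thesis .
  qed
  from this[of x y] this[of y x] show ?thesis by (simp add: padic_abs_diff_commute)
qed

lemma padic_cauchy_convergent_abs:
  assumes "padic_cauchy p f"
  shows "convergent (\<lambda>n. padic_abs p (f n))"
proof -
  have "Cauchy (\<lambda>n. padic_abs p (f n))"
    using assms abs_padic_abs_diff_le unfolding Cauchy_def padic_cauchy_def dist_real_def
    by (meson le_less_trans)
  then show ?thesis by (simp add: Cauchy_convergent_iff)
qed

lemma padic_cauchy_bounded: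
  assumes "padic_cauchy p f"
  obtains C where "C > 0" "\<forall>n. padic_abs p (f n) \<le> C"
proof -
  obtain K where "K > 0" "\<forall>n. norm (padic_abs p (f n)) \<le> K"
    using convergent_imp_Bseq[OF padic_cauchy_convergent_abs[OF assms]] by (rule BseqE)
  then show ?thesis using that by auto
qed

lemma padic_cauchyI:
  assumes "\<And>e. e > 0 \<Longrightarrow> \<forall>\<^sub>F N in sequentially. \<forall>m\<ge>N. \<forall>n\<ge>N. padic_abs p (f m - f n) < e"
  shows "padic_cauchy p f"
  using assms unfolding padic_cauchy_def eventually_sequentially by blast

lemma padic_cauchyD:
  assumes "padic_cauchy p f" "e > 0"
  shows "\<forall>\<^sub>F N in sequentially. \<forall>m\<ge>N. \<forall>n\<ge>N. padic_abs p (f m - f n) < e"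
  using assms unfolding padic_cauchy_def eventually_sequentially by (meson order.trans)

lemma padic_cauchy_const [simp]: "padic_cauchy p (\<lambda>n. q)"
  by (simp add: padic_cauchy_def)

lemma padic_cauchy_minus [simp]: "padic_cauchy p f \<Longrightarrow> padic_cauchy p (\<lambda>n. - f n)"
  by (simp add: padic_cauchy_def padic_abs_diff_commute)

lemma padic_cauchy_add [simp]:
  assumes f: "padic_cauchy p f" and g: "padic_cauchy p g"
  shows "padic_cauchy p (\<lambda>n. f n + g n)"
proof (rule padic_cauchyI)
  fix e :: real assume e: "e > 0"
  from padic_cauchyD[OF f e] padic_cauchyD[OF g e]
  show "\<forall>\<^sub>F N in sequentially. \<forall>m\<ge>N. \<forall>n\<ge>N. padic_abs p (f m + g m - (f n + g n)) < e"
  proof eventually_elim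
    case (elim N)
    have "padic_abs p (f m + g m - (f n + g n)) < e" if "m \<ge> N" "n \<ge> N" for m n
    proof -
      have "padic_abs p (f m - f n) < e" "padic_abs p (g m - g n) < e" using elim that by auto
      then show ?thesis using padic_abs_add[of "f m - f n" "g m - g n"]
        by (simp add: add_diff_add)
    qed
    then show ?case by blast
  qed
qed

lemma padic_cauchy_diff [simp]:
  "padic_cauchy p f \<Longrightarrow> padic_cauchy p g \<Longrightarrow> padic_cauchy p (\<lambda>n. f n - g n)"
  using padic_cauchy_add[of f "\<lambda>n. - g n"] by simp

lemma padic_cauchy_mult [simp]:
  assumes f: "padic_cauchy p f" and g: "padic_cauchy p g"
  shows "padic_cauchy p (\<lambda>n. f n * g n)"
proof (rule padic_cauchyI)
  fix e :: real assume e: "e > 0"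
  obtain C where C: "C > 0" "\<forall>n. padic_abs p (f n) \<le> C" by (rule padic_cauchy_bounded[OF f])
  obtain D where D: "D > 0" "\<forall>n. padic_abs p (g n) \<le> D" by (rule padic_cauchy_bounded[OF g])
  have "e / D > 0" "e / C > 0" using e C D by auto
  from padic_cauchyD[OF f this(1)] padic_cauchyD[OF g this(2)]
  show "\<forall>\<^sub>F N in sequentially. \<forall>m\<ge>N. \<forall>n\<ge>N. padic_abs p (f m * g m - f n * g n) < e"
  proof eventually_elim
    case (elim N)
    have "padic_abs p (f m * g m - f n * g n) < e" if mn: "m \<ge> N" "n \<ge> N" for m n
    proof -
      have 1: "padic_abs p ((f m - f n) * g m) < e"
      proof -
        have "padic_abs p (f m - f n) * padic_abs p (g m) \<le> padic_abs p (f m - f n) * D"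
          using D by (intro mult_left_mono) auto
        also have "\<dots> < e" using elim mn D by (simp add: pos_less_divide_eq)
        finally show ?thesis by (simp add: padic_abs_mult)
      qed
      have 2: "padic_abs p (f n * (g m - g n)) < e"
      proof -
        have "padic_abs p (f n) * padic_abs p (g m - g n) \<le> C * padic_abs p (g m - g n)"
          using C by (intro mult_right_mono) auto
        also have "\<dots> < e" using elim mn C by (simp add: pos_less_divide_eq mult.commute)
        finally show ?thesis by (simp add: padic_abs_mult)
      qed
      have "f m * g m - f n * g n = (f m - f n) * g m + f n * (g m - g n)"
        by (simp add: algebra_simps)
      then show ?thesis
        using 1 2 padic_abs_add[of "(f m - f n) * g m" "f n * (g m - g n)"] by simp
    qed
    then show ?case by blast
  qed
qed

lemma padic_null_trans:
  assumes "(\<lambda>n. padic_abs p (f n - g n)) \<longlonglongrightarrow> 0" "(\<lambda>n. padic_abs p (g n - h n)) \<longlonglongrightarrow> 0"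
  shows "(\<lambda>n. padic_abs p (f n - h n)) \<longlonglongrightarrow> 0"
proof (rule Lim_null_comparison)
  show "(\<lambda>n. max (padic_abs p (f n - g n)) (padic_abs p (g n - h n))) \<longlonglongrightarrow> 0"
    using tendsto_max[OF assms] by simp
  show "\<forall>\<^sub>F n in sequentially. norm (padic_abs p (f n - h n))
    \<le> max (padic_abs p (f n - g n)) (padic_abs p (g n - h n))"
    by (rule always_eventually) (use padic_abs_triangle in simp)
qed

lemma padic_null_commute:
  "(\<lambda>n. padic_abs p (f n - g n)) \<longlonglongrightarrow> 0 \<longleftrightarrow> (\<lambda>n. padic_abs p (g n - f n)) \<longlonglongrightarrow> 0"
  by (subst padic_abs_diff_commute) simp

section \<open>Equivalence classes of Cauchy sequences and their arithmetic\<close>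

lemma qp_class_eqI:
  assumes "(\<lambda>n. padic_abs p (f n - g n)) \<longlonglongrightarrow> 0"
  shows "qp_class p f = qp_class p g"
  using assms padic_null_trans padic_null_commute unfolding qp_class_def by blast

lemma qp_class_eq_iff:
  assumes "padic_cauchy p f" "padic_cauchy p g"
  shows "qp_class p f = qp_class p g \<longleftrightarrow> (\<lambda>n. padic_abs p (f n - g n)) \<longlonglongrightarrow> 0"
proof
  assume "qp_class p f = qp_class p g"
  moreover have "g \<in> qp_class p g" using assms by (simp add: qp_class_def)
  ultimately have "g \<in> qp_class p f" by simp
  then show "(\<lambda>n. padic_abs p (f n - g n)) \<longlonglongrightarrow> 0" by (simp add: qp_class_def)
qed (rule qp_class_eqI)

lemma qp_rep_class:
  assumes "padic_cauchy p f"
  shows "padic_cauchy p (qp_rep (qp_class p f))"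
    and "(\<lambda>n. padic_abs p (f n - qp_rep (qp_class p f) n)) \<longlonglongrightarrow> 0"
proof -
  have "f \<in> qp_class p f" using assms by (simp add: qp_class_def)
  then have "qp_rep (qp_class p f) \<in> qp_class p f" unfolding qp_rep_def by (auto simp: some_in_eq)
  then show "padic_cauchy p (qp_rep (qp_class p f))"
    and "(\<lambda>n. padic_abs p (f n - qp_rep (qp_class p f) n)) \<longlonglongrightarrow> 0"
    by (auto simp: qp_class_def)
qed

lemma Qp_cases:
  assumes "x \<in> Qp p"
  obtains f where "padic_cauchy p f" "x = qp_class p f"
  using assms by (auto simp: Qp_def)

lemma qp_class_in_Qp [simp]: "padic_cauchy p f \<Longrightarrow> qp_class p f \<in> Qp p"
  by (auto simp: Qp_def)

lemma padic_null_add: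
  assumes "(\<lambda>n. padic_abs p (f n - f' n)) \<longlonglongrightarrow> 0" "(\<lambda>n. padic_abs p (g n - g' n)) \<longlonglongrightarrow> 0"
  shows "(\<lambda>n. padic_abs p ((f n + g n) - (f' n + g' n))) \<longlonglongrightarrow> 0"
proof (rule Lim_null_comparison)
  show "(\<lambda>n. max (padic_abs p (f n - f' n)) (padic_abs p (g n - g' n))) \<longlonglongrightarrow> 0"
    using tendsto_max[OF assms] by simp
  show "\<forall>\<^sub>F n in sequentially. norm (padic_abs p ((f n + g n) - (f' n + g' n)))
    \<le> max (padic_abs p (f n - f' n)) (padic_abs p (g n - g' n))"
    by (rule always_eventually) (use padic_abs_add in \<open>simp add: add_diff_add\<close>)
qed

text \<open>Both products are compared with \<open>f n * g' n\<close>. This uses that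
  \<open>f\<close> and \<open>g'\<close> are bounded, which is why these two are the sequences
  assumed Cauchy.\<close>

lemma padic_null_mult:
  assumes f: "padic_cauchy p f" and f': "(\<lambda>n. padic_abs p (f n - f' n)) \<longlonglongrightarrow> 0"
    and g: "padic_cauchy p g'" and g': "(\<lambda>n. padic_abs p (g n - g' n)) \<longlonglongrightarrow> 0"
  shows "(\<lambda>n. padic_abs p (f n * g n - f' n * g' n)) \<longlonglongrightarrow> 0"
proof (rule padic_null_trans)
  have "(\<lambda>n. padic_abs p (f n) * padic_abs p (g n - g' n)) \<longlonglongrightarrow> 0"
  proof -
    obtain C where "\<forall>n. padic_abs p (f n) \<le> C" using f by (rule padic_cauchy_bounded)
    then show ?thesis using g' by (intro lim_null_mult_left_bounded[where B=C]) auto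
  qed
  then show "(\<lambda>n. padic_abs p (f n * g n - f n * g' n)) \<longlonglongrightarrow> 0"
    by (simp flip: padic_abs_mult add: algebra_simps)
  have "(\<lambda>n. padic_abs p (f n - f' n) * padic_abs p (g' n)) \<longlonglongrightarrow> 0"
  proof -
    obtain C where "\<forall>n. padic_abs p (g' n) \<le> C" using g by (rule padic_cauchy_bounded)
    then show ?thesis using f' by (intro lim_null_mult_right_bounded[where B=C]) auto
  qed
  then show "(\<lambda>n. padic_abs p (f n * g' n - f' n * g' n)) \<longlonglongrightarrow> 0"
    by (simp flip: padic_abs_mult add: algebra_simps)
qed

lemma qp_add_class:
  assumes "padic_cauchy p f" "padic_cauchy p g"
  shows "qp_add p (qp_class p f) (qp_class p g) = qp_class p (\<lambda>n. f n + g n)"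
  unfolding qp_add_def
  by (rule qp_class_eqI[symmetric], rule padic_null_add) (use assms in \<open>auto simp: qp_rep_class\<close>)

lemma qp_neg_class:
  assumes "padic_cauchy p f"
  shows "qp_neg p (qp_class p f) = qp_class p (\<lambda>n. - f n)"
  unfolding qp_neg_def
proof (rule qp_class_eqI[symmetric])
  show "(\<lambda>n. padic_abs p (- f n - - qp_rep (qp_class p f) n)) \<longlonglongrightarrow> 0"
    using qp_rep_class(2)[OF assms] padic_abs_minus[of "f _ - qp_rep (qp_class p f) _"] by simp
qed

lemma qp_mult_class:
  assumes "padic_cauchy p f" "padic_cauchy p g"
  shows "qp_mult p (qp_class p f) (qp_class p g) = qp_class p (\<lambda>n. f n * g n)"
  unfolding qp_mult_def
  by (rule qp_class_eqI[symmetric], rule padic_null_mult) (use assms in \<open>auto simp: qp_rep_class\<close>)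

text \<open>\<open>qp_abs\<close> is defined through a chosen representative. The absolute values
  along two representatives differ by a null sequence, so every Cauchy sequence in the class may be
  used, and inequalities for rationals pass to the limit.\<close>

lemma qp_abs_class_tendsto:
  assumes "padic_cauchy p f"
  shows "(\<lambda>n. padic_abs p (f n)) \<longlonglongrightarrow> qp_abs p (qp_class p f)"
proof -
  let ?r = "qp_rep (qp_class p f)"
  have "(\<lambda>n. padic_abs p (?r n)) \<longlonglongrightarrow> qp_abs p (qp_class p f)"
    unfolding qp_abs_def using padic_cauchy_convergent_abs[OF qp_rep_class(1)[OF assms]]
    by (simp add: convergent_LIMSEQ_iff)
  moreover have "(\<lambda>n. padic_abs p (f n) - padic_abs p (?r n)) \<longlonglongrightarrow> 0"
    by (rule Lim_null_comparison[OF _ qp_rep_class(2)[OF assms]]) (simp add: abs_padic_abs_diff_le)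
  ultimately show ?thesis by (rule Lim_transform)
qed

lemma qp_dist_class_tendsto:
  assumes "padic_cauchy p f" "padic_cauchy p g"
  shows "(\<lambda>n. padic_abs p (f n - g n)) \<longlonglongrightarrow> qp_dist p (qp_class p f) (qp_class p g)"
  using qp_abs_class_tendsto[of "\<lambda>n. f n + - g n"] assms
  by (simp add: qp_dist_def qp_neg_class qp_add_class)

definition qp_const :: "rat \<Rightarrow> qp" where
  "qp_const q = qp_class p (\<lambda>n. q)"

lemma qp_const_in_Qp [simp]: "qp_const q \<in> Qp p"
  by (simp add: qp_const_def)

lemma qp_abs_const [simp]: "qp_abs p (qp_const q) = padic_abs p q"
  using qp_abs_class_tendsto[of "\<lambda>n. q"] by (simp add: qp_const_def LIMSEQ_const_iff)

lemma qp_add_in_Qp [simp]: "x \<in> Qp p \<Longrightarrow> y \<in> Qp p \<Longrightarrow> qp_add p x y \<in> Qp p"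
  by (elim Qp_cases) (simp add: qp_add_class)

lemma qp_neg_in_Qp [simp]: "x \<in> Qp p \<Longrightarrow> qp_neg p x \<in> Qp p"
  by (elim Qp_cases) (simp add: qp_neg_class)

lemma qp_mult_in_Qp [simp]: "x \<in> Qp p \<Longrightarrow> y \<in> Qp p \<Longrightarrow> qp_mult p x y \<in> Qp p"
  by (elim Qp_cases) (simp add: qp_mult_class)

lemma qp_add_commute: "qp_add p x y = qp_add p y x"
  by (simp add: qp_add_def add.commute)

lemma qp_add_assoc:
  "x \<in> Qp p \<Longrightarrow> y \<in> Qp p \<Longrightarrow> z \<in> Qp p \<Longrightarrow>
    qp_add p (qp_add p x y) z = qp_add p x (qp_add p y z)"
  by (elim Qp_cases) (simp add: qp_add_class add.assoc)

lemma qp_add_0 [simp]: "x \<in> Qp p \<Longrightarrow> qp_add p x (qp_const 0) = x"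
  by (elim Qp_cases) (simp add: qp_add_class qp_const_def)

lemma qp_add_neg [simp]: "x \<in> Qp p \<Longrightarrow> qp_add p x (qp_neg p x) = qp_const 0"
  by (elim Qp_cases) (simp add: qp_add_class qp_neg_class qp_const_def)

lemma qp_mult_add:
  "a \<in> Qp p \<Longrightarrow> x \<in> Qp p \<Longrightarrow> y \<in> Qp p \<Longrightarrow>
    qp_mult p a (qp_add p x y) = qp_add p (qp_mult p a x) (qp_mult p a y)"
  by (elim Qp_cases) (simp add: qp_add_class qp_mult_class ring_distribs)

lemma qp_mult_const_const:
  "x \<in> Qp p \<Longrightarrow> qp_mult p (qp_const r) (qp_mult p (qp_const s) x) = qp_mult p (qp_const (r * s)) x"
  by (elim Qp_cases) (simp add: qp_mult_class qp_const_def mult.assoc)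

lemma qp_mult_1 [simp]: "x \<in> Qp p \<Longrightarrow> qp_mult p (qp_const 1) x = x"
  by (elim Qp_cases) (simp add: qp_mult_class qp_const_def)

section \<open>The ultrametric on Q_p\<close>

lemma qp_dist_self [simp]: "x \<in> Qp p \<Longrightarrow> qp_dist p x x = 0"
  by (simp add: qp_dist_def)

lemma qp_dist_nonneg: "x \<in> Qp p \<Longrightarrow> y \<in> Qp p \<Longrightarrow> qp_dist p x y \<ge> 0"
  by (elim Qp_cases) (auto intro!: LIMSEQ_le_const[OF qp_dist_class_tendsto])

lemma qp_dist_commute:
  assumes "x \<in> Qp p" "y \<in> Qp p"
  shows "qp_dist p x y = qp_dist p y x"
proof -
  obtain f where fgf: "padic_cauchy p f" "x = qp_class p f"
    using assms(1) by (rule Qp_cases)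
  obtain g where fgg: "padic_cauchy p g" "y = qp_class p g"
    using assms(2) by (rule Qp_cases)
  note fg = fgf fgg
  have "(\<lambda>n. padic_abs p (f n - g n)) \<longlonglongrightarrow> qp_dist p y x"
    using qp_dist_class_tendsto[of g f] fg by (simp add: padic_abs_diff_commute)
  moreover have "(\<lambda>n. padic_abs p (f n - g n)) \<longlonglongrightarrow> qp_dist p x y"
    using qp_dist_class_tendsto[of f g] fg by simp
  ultimately show ?thesis by (metis LIMSEQ_unique)
qed

lemma qp_dist_eq_0:
  "x \<in> Qp p \<Longrightarrow> y \<in> Qp p \<Longrightarrow> qp_dist p x y = 0 \<longleftrightarrow> x = y"
  by (elim Qp_cases) (metis qp_class_eq_iff qp_dist_class_tendsto qp_dist_self qp_class_in_Qp)

lemma qp_dist_triangle: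
  assumes "x \<in> Qp p" "y \<in> Qp p" "z \<in> Qp p"
  shows "qp_dist p x z \<le> max (qp_dist p x y) (qp_dist p y z)"
proof -
  obtain f where fgf: "padic_cauchy p f" "x = qp_class p f"
    using assms(1) by (rule Qp_cases)
  obtain g where fgg: "padic_cauchy p g" "y = qp_class p g"
    using assms(2) by (rule Qp_cases)
  obtain h where fgh: "padic_cauchy p h" "z = qp_class p h"
    using assms(3) by (rule Qp_cases)
  from fgf fgg fgh show ?thesis
    by (auto intro!: LIMSEQ_le[OF qp_dist_class_tendsto tendsto_max[OF qp_dist_class_tendsto qp_dist_class_tendsto]]
       padic_abs_triangle)
qed

lemma qp_dist_add:
  assumes "x \<in> Qp p" "y \<in> Qp p" "x' \<in> Qp p" "y' \<in> Qp p"
  shows "qp_dist p (qp_add p x y) (qp_add p x' y') \<le> max (qp_dist p x x') (qp_dist p y y')"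
proof -
  obtain f where fgf: "padic_cauchy p f" "x = qp_class p f"
    using assms(1) by (rule Qp_cases)
  obtain g where fgg: "padic_cauchy p g" "y = qp_class p g"
    using assms(2) by (rule Qp_cases)
  obtain f' where fgf': "padic_cauchy p f'" "x' = qp_class p f'"
    using assms(3) by (rule Qp_cases)
  obtain g' where fgg': "padic_cauchy p g'" "y' = qp_class p g'"
    using assms(4) by (rule Qp_cases)
  from fgf fgg fgf' fgg' show ?thesis
    by (auto simp: qp_add_class padic_abs_add add_diff_add
        intro!: LIMSEQ_le[OF qp_dist_class_tendsto tendsto_max[OF qp_dist_class_tendsto qp_dist_class_tendsto]])
qed

lemma qp_dist_neg:
  assumes "x \<in> Qp p" "y \<in> Qp p"
  shows "qp_dist p (qp_neg p x) (qp_neg p y) = qp_dist p x y"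
proof -
  obtain f where fgf: "padic_cauchy p f" "x = qp_class p f"
    using assms(1) by (rule Qp_cases)
  obtain g where fgg: "padic_cauchy p g" "y = qp_class p g"
    using assms(2) by (rule Qp_cases)
  note fg = fgf fgg
  have "(\<lambda>n. padic_abs p (f n - g n)) \<longlonglongrightarrow> qp_dist p (qp_neg p x) (qp_neg p y)"
    using qp_dist_class_tendsto[of "\<lambda>n. - f n" "\<lambda>n. - g n"] fg
    by (simp add: padic_abs_diff_commute qp_neg_class)
  moreover have "(\<lambda>n. padic_abs p (f n - g n)) \<longlonglongrightarrow> qp_dist p x y"
    using qp_dist_class_tendsto[of f g] fg by simp
  ultimately show ?thesis by (metis LIMSEQ_unique)
qed

lemma qp_dist_mult:
  assumes "a \<in> Qp p" "x \<in> Qp p" "y \<in> Qp p"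
  shows "qp_dist p (qp_mult p a x) (qp_mult p a y) = qp_abs p a * qp_dist p x y"
proof -
  obtain f where fgf: "padic_cauchy p f" "x = qp_class p f"
    using assms(2) by (rule Qp_cases)
  obtain g where fgg: "padic_cauchy p g" "y = qp_class p g"
    using assms(3) by (rule Qp_cases)
  obtain h where fgh: "padic_cauchy p h" "a = qp_class p h"
    using assms(1) by (rule Qp_cases)
  note fg = fgf fgg fgh
  have "(\<lambda>n. padic_abs p (h n) * padic_abs p (f n - g n)) \<longlonglongrightarrow> qp_dist p (qp_mult p a x) (qp_mult p a y)"
    using qp_dist_class_tendsto[of "\<lambda>n. h n * f n" "\<lambda>n. h n * g n"] fg
    by (simp add: qp_mult_class ring_distribs flip: padic_abs_mult)
  moreover have "(\<lambda>n. padic_abs p (h n) * padic_abs p (f n - g n)) \<longlonglongrightarrow> qp_abs p a * qp_dist p x y"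
    using fg by (auto intro!: tendsto_mult qp_dist_class_tendsto qp_abs_class_tendsto)
  ultimately show ?thesis by (rule LIMSEQ_unique)
qed

lemma qp_neg_const_0 [simp]: "qp_neg p (qp_const 0) = qp_const 0"
  by (simp add: qp_const_def qp_neg_class)

lemma qp_mult_const_0 [simp]: "a \<in> Qp p \<Longrightarrow> qp_mult p a (qp_const 0) = qp_const 0"
  by (elim Qp_cases) (simp add: qp_mult_class qp_const_def)

lemma qp_dist_0 [simp]: "x \<in> Qp p \<Longrightarrow> qp_dist p x (qp_const 0) = qp_abs p x"
  by (simp add: qp_dist_def)

lemma qp_dist_const [simp]: "qp_dist p (qp_const r) (qp_const s) = padic_abs p (r - s)"
  using qp_dist_class_tendsto[of "\<lambda>n. r" "\<lambda>n. s"] by (simp add: qp_const_def LIMSEQ_const_iff)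

lemma qp_dist_class_const_le:
  assumes "padic_cauchy p f" "\<And>m. m \<ge> N \<Longrightarrow> padic_abs p (f m - q) \<le> e"
  shows "qp_dist p (qp_class p f) (qp_const q) \<le> e"
  using qp_dist_class_tendsto[OF assms(1), of "\<lambda>n. q"] assms(2) unfolding qp_const_def
  by (intro LIMSEQ_le_const2) auto

section \<open>Completeness of Q_p and compactness of Z_p\<close>

lemma qp_const_dense:
  assumes "x \<in> Qp p" "e > 0"
  shows "\<exists>q. qp_dist p x (qp_const q) < e"
proof -
  obtain f where f: "padic_cauchy p f" "x = qp_class p f" using assms(1) by (rule Qp_cases)
  \<comment> \<open>Only a non-strict bound survives the passage to the limit, so the Cauchy
    condition is used with \<open>e / 2\<close>.\<close>
  have "e / 2 > 0" using assms by simp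
  then obtain N where "\<forall>m\<ge>N. \<forall>n\<ge>N. padic_abs p (f m - f n) < e / 2"
    using f(1) unfolding padic_cauchy_def by blast
  then have "qp_dist p x (qp_const (f N)) \<le> e / 2"
    unfolding f(2) by (intro qp_dist_class_const_le[OF f(1), of N]) (auto intro: less_imp_le)
  then show ?thesis using assms(2) by (intro exI[of _ "f N"]) simp
qed

text \<open>A diagonal argument: rationals \<open>q n\<close> within 1/(n+1) of \<open>x n\<close>
  form a Cauchy sequence, and its class is the limit.\<close>

lemma qp_complete:
  assumes x: "\<And>n. x n \<in> Qp p"
    and cau: "\<And>e. e > 0 \<Longrightarrow> \<exists>N. \<forall>m\<ge>N. \<forall>n\<ge>N. qp_dist p (x m) (x n) < e"
  obtains l where "l \<in> Qp p" "(\<lambda>n. qp_dist p (x n) l) \<longlonglongrightarrow> 0"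
proof -
  have "\<forall>n. \<exists>q. qp_dist p (x n) (qp_const q) < inverse (real (Suc n))"
    using qp_const_dense x by simp
  then obtain q where q: "\<And>n. qp_dist p (x n) (qp_const (q n)) < inverse (real (Suc n))"
    by metis
  have close: "\<exists>N. \<forall>n\<ge>N. qp_dist p (x n) (qp_const (q n)) < e" if e: "e > 0" for e
  proof -
    obtain N where N: "inverse (real (Suc N)) < e" using reals_Archimedean[OF e] by blast
    have "qp_dist p (x n) (qp_const (q n)) < e" if "n \<ge> N" for n
    proof -
      have "inverse (real (Suc n)) \<le> inverse (real (Suc N))" using that by simp
      then show ?thesis using q[of n] N by linarith
    qed
    then show ?thesis by blast
  qed
  have cq: "padic_cauchy p q"
    unfolding padic_cauchy_def
  proof (intro allI impI)
    fix e :: real assume e: "e > 0"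
    obtain N1 where N1: "\<forall>m\<ge>N1. \<forall>n\<ge>N1. qp_dist p (x m) (x n) < e" using cau[OF e] by blast
    obtain N2 where N2: "\<forall>n\<ge>N2. qp_dist p (x n) (qp_const (q n)) < e" using close[OF e] by blast
    have "padic_abs p (q m - q n) < e" if "m \<ge> max N1 N2" "n \<ge> max N1 N2" for m n
    proof -
      have "qp_dist p (qp_const (q m)) (x m) < e" "qp_dist p (x m) (x n) < e"
        "qp_dist p (x n) (qp_const (q n)) < e"
        using N1 N2 that qp_dist_commute[OF x, of "qp_const (q m)" m] by auto
      then have "qp_dist p (qp_const (q m)) (qp_const (q n)) < e"
        using qp_dist_triangle[of "qp_const (q m)" "x m" "qp_const (q n)"]
          qp_dist_triangle[of "x m" "x n" "qp_const (q n)"] x by simp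
      then show ?thesis by simp
    qed
    then show "\<exists>N. \<forall>m\<ge>N. \<forall>n\<ge>N. padic_abs p (q m - q n) < e" by blast
  qed
  let ?l = "qp_class p q"
  have l: "?l \<in> Qp p" using cq by simp
  have "(\<lambda>n. qp_dist p (x n) ?l) \<longlonglongrightarrow> 0"
  proof (rule LIMSEQ_I)
    fix e :: real assume e: "e > 0"
    obtain N1 where N1: "\<forall>n\<ge>N1. qp_dist p (x n) (qp_const (q n)) < e" using close[OF e] by blast
    have "e / 2 > 0" using e by simp
    then obtain N2 where N2: "\<forall>m\<ge>N2. \<forall>n\<ge>N2. padic_abs p (q m - q n) < e / 2"
      using cq unfolding padic_cauchy_def by blast
    have "norm (qp_dist p (x n) ?l - 0) < e" if n: "n \<ge> max N1 N2" for n
    proof -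
      have "qp_dist p ?l (qp_const (q n)) \<le> e / 2"
        using N2 n by (intro qp_dist_class_const_le[OF cq, of N2]) (auto intro: less_imp_le)
      then have "qp_dist p (qp_const (q n)) ?l < e"
        using qp_dist_commute[OF l qp_const_in_Qp] e by simp
      moreover have "qp_dist p (x n) (qp_const (q n)) < e" using N1 n by simp
      ultimately have "qp_dist p (x n) ?l < e"
        using qp_dist_triangle[of "x n" "qp_const (q n)" ?l] x l by simp
      then show ?thesis using qp_dist_nonneg[OF x l] by simp
    qed
    then show "\<exists>N. \<forall>n\<ge>N. norm (qp_dist p (x n) ?l - 0) < e" by blast
  qed
  then show ?thesis using that l by blast
qed

text \<open>\<open>Metric_space\<close> wants nonnegativity and symmetry off the carrier too, where
  \<open>qp_dist\<close> is arbitrary.\<close>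
definition qp_mdist :: "qp \<Rightarrow> qp \<Rightarrow> real" where
  "qp_mdist x y = (if x \<in> Qp p \<and> y \<in> Qp p then qp_dist p x y else 0)"

lemma qp_mdist_eq [simp]: "x \<in> Qp p \<Longrightarrow> y \<in> Qp p \<Longrightarrow> qp_mdist x y = qp_dist p x y"
  by (simp add: qp_mdist_def)

sublocale qpm: Metric_space "Qp p" qp_mdist
proof
  show "0 \<le> qp_mdist x y" for x y by (simp add: qp_mdist_def qp_dist_nonneg)
  show "qp_mdist x y = qp_mdist y x" for x y by (simp add: qp_mdist_def qp_dist_commute)
  show "qp_mdist x y = 0 \<longleftrightarrow> x = y" if "x \<in> Qp p" "y \<in> Qp p" for x y
    using that by (simp add: qp_dist_eq_0)
  show "qp_mdist x z \<le> qp_mdist x y + qp_mdist y z" if "x \<in> Qp p" "y \<in> Qp p" "z \<in> Qp p" for x y z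
  proof -
    have "qp_mdist x z \<le> max (qp_mdist x y) (qp_mdist y z)"
      using that by (simp add: qp_dist_triangle)
    also have "\<dots> \<le> qp_mdist x y + qp_mdist y z"
      using that by (simp add: qp_dist_nonneg)
    finally show ?thesis .
  qed
qed

lemma qp_top_eq: "qp_top p = qpm.mtopology"
proof -
  have "(\<lambda>U. U \<subseteq> Qp p \<and> (\<forall>x\<in>U. \<exists>e>0. \<forall>y\<in>Qp p. qp_dist p x y < e \<longrightarrow> y \<in> U)) = qpm.mopen"
    (is "?L = _")
  proof (rule ext)
    fix U
    have *: "(\<forall>y\<in>Qp p. qp_dist p x y < e \<longrightarrow> y \<in> U) \<longleftrightarrow> qpm.mball x e \<subseteq> U"
      if "x \<in> Qp p" for x e
      unfolding qpm.mball_def subset_iff using that by (simp add: Ball_def imp_conjL)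
    show "?L U = qpm.mopen U"
    proof (cases "U \<subseteq> Qp p")
      case True
      then have "(\<forall>y\<in>Qp p. qp_dist p x y < e \<longrightarrow> y \<in> U) \<longleftrightarrow> qpm.mball x e \<subseteq> U"
        if "x \<in> U" for x e using * that by blast
      then show ?thesis using True by (simp add: qpm.mopen_def Ball_def)
    qed (simp add: qpm.mopen_def)
  qed
  then show ?thesis unfolding qp_top_def qpm.mtopology_def by simp
qed

lemma qp_mcomplete: "qpm.mcomplete"
  unfolding qpm.mcomplete_def
proof (intro allI impI)
  fix s assume s: "qpm.MCauchy s"
  then have sQ: "s n \<in> Qp p" for n by (auto simp: qpm.MCauchy_def)
  have "\<exists>N. \<forall>m\<ge>N. \<forall>n\<ge>N. qp_dist p (s m) (s n) < e" if "e > 0" for e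
    using s that sQ unfolding qpm.MCauchy_def by (metis qp_mdist_eq)
  then obtain l where l: "l \<in> Qp p" "(\<lambda>n. qp_dist p (s n) l) \<longlonglongrightarrow> 0"
    using qp_complete[of s] sQ by blast
  have "\<exists>N. \<forall>n\<ge>N. s n \<in> Qp p \<and> qp_mdist (s n) l < e" if "e > 0" for e
    using LIMSEQ_D[OF l(2) that] sQ l(1) by (force simp: abs_of_nonneg qp_dist_nonneg)
  then show "\<exists>x. limitin qpm.mtopology s x sequentially"
    using l(1) unfolding qpm.limit_metric_sequentially by blast
qed

lemma Zp_eq_mcball: "Zp p = qpm.mcball (qp_const 0) 1"
  by (auto simp: Zp_def qpm.mcball_def qp_dist_commute[of "qp_const 0"])

lemma qp_const_int_in_Zp: "qp_const (of_int z) \<in> Zp p"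
  by (simp add: Zp_def padic_abs_int_le_1)

lemma inverse_p_power_less:
  assumes "e > 0"
  obtains n where "1 / real p ^ n < e"
proof -
  have "inverse (real p) < 1" using p_gt_1 by (simp add: field_simps)
  then obtain n where "inverse (real p) ^ n < e"
    using real_arch_pow_inv[OF assms] by blast
  then show ?thesis using that by (simp add: inverse_eq_divide power_divide)
qed

lemma qp_abs_le_max_dist:
  "x \<in> Qp p \<Longrightarrow> y \<in> Qp p \<Longrightarrow> qp_abs p x \<le> max (qp_abs p y) (qp_dist p x y)"
  using qp_dist_triangle[of x y "qp_const 0"] by (simp add: max.commute)

text \<open>In a complete metric space a closed totally bounded set is compact; the integers below
  p^n form a finite net of Z_p.\<close>

lemma compactin_Zp: "compactin (qp_top p) (Zp p)"
proof -
  have "qpm.mtotally_bounded (Zp p)"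
    unfolding qpm.mtotally_bounded_def
  proof (intro allI impI)
    fix e :: real assume e: "e > 0"
    obtain n where n: "1 / real p ^ n < e" using inverse_p_power_less[OF e] .
    let ?K = "(\<lambda>z. qp_const (of_int z)) ` {0..<int p ^ n}"
    have "x \<in> (\<Union>c\<in>?K. qpm.mball c e)" if x: "x \<in> Zp p" for x
    proof -
      have xQ: "x \<in> Qp p" and x1: "qp_abs p x \<le> 1" using x by (auto simp: Zp_def)
      \<comment> \<open>The bound 1 keeps the approximating rational in the unit ball, where
        \<open>padic_abs_int_approx\<close> applies.\<close>
      have "min e 1 > 0" using e by simp
      then obtain q where q: "qp_dist p x (qp_const q) < min e 1" using qp_const_dense[OF xQ] by blast
      have "padic_abs p q \<le> 1"
        using qp_abs_le_max_dist[of "qp_const q" x] q x1 xQ by (auto simp: qp_dist_commute)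
      then obtain z where z: "z \<in> {0..<int p ^ n}" "padic_abs p (q - of_int z) \<le> 1 / real p ^ n"
        using padic_abs_int_approx by blast
      have "qp_dist p x (qp_const (of_int z)) < e"
        using qp_dist_triangle[of x "qp_const q" "qp_const (of_int z)"] q z n xQ by auto
      then show ?thesis using z(1) xQ by (auto simp: qp_dist_commute)
    qed
    then have "Zp p \<subseteq> (\<Union>c\<in>?K. qpm.mball c e)" by blast
    moreover have "finite ?K" "?K \<subseteq> Zp p" by (auto simp: qp_const_int_in_Zp)
    ultimately show "\<exists>K. finite K \<and> K \<subseteq> Zp p \<and> Zp p \<subseteq> (\<Union>x\<in>K. qpm.mball x e)" by blast
  qed
  then have "compactin qpm.mtopology (qpm.mtopology closure_of (Zp p))"
    using qpm.mtotally_bounded_eq_compact_closure_of[OF qp_mcomplete] by blast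
  moreover have "qpm.mtopology closure_of (Zp p) = Zp p"
    unfolding Zp_eq_mcball by (intro closure_of_closedin) simp
  ultimately show ?thesis by (simp add: qp_top_eq)
qed

end

section \<open>The restricted product and its topology\<close>

context padic
begin

section \<open>Coordinatewise arithmetic and closeness of vectors\<close>

lemma QpN_finite: "\<xi> \<in> QpN p \<Longrightarrow> finite {i. qp_abs p (\<xi> i) > 1}"
  by (simp add: QpN_def)

lemma QpNI: "(\<And>i. \<xi> i \<in> Qp p) \<Longrightarrow> finite {i. qp_abs p (\<xi> i) > 1} \<Longrightarrow> \<xi> \<in> QpN p"
  by (simp add: QpN_def)

lemma QpN_coord [simp]: "\<xi> \<in> QpN p \<Longrightarrow> \<xi> i \<in> Qp p"
  by (simp add: QpN_def)

definition vzero :: qpN where "vzero = (\<lambda>i. qp_const 0)"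

lemma vzero_apply: "vzero i = qp_const 0"
  by (simp add: vzero_def)

lemma vzero_in_QpN [simp]: "vzero \<in> QpN p"
  by (rule QpNI) (auto simp: vzero_apply)

lemma qp_abs_nonneg: "x \<in> Qp p \<Longrightarrow> qp_abs p x \<ge> 0"
  using qp_dist_nonneg[of x "qp_const 0"] by simp

lemma qp_abs_add: "x \<in> Qp p \<Longrightarrow> y \<in> Qp p \<Longrightarrow> qp_abs p (qp_add p x y) \<le> max (qp_abs p x) (qp_abs p y)"
  using qp_dist_add[of x y "qp_const 0" "qp_const 0"] by simp

lemma qp_abs_neg [simp]: "x \<in> Qp p \<Longrightarrow> qp_abs p (qp_neg p x) = qp_abs p x"
  using qp_dist_neg[of x "qp_const 0"] by simp

lemma qp_abs_mult: "a \<in> Qp p \<Longrightarrow> x \<in> Qp p \<Longrightarrow> qp_abs p (qp_mult p a x) = qp_abs p a * qp_abs p x"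
  using qp_dist_mult[of a x "qp_const 0"] by simp

lemma qp_dist_triangle_le:
  "x \<in> Qp p \<Longrightarrow> y \<in> Qp p \<Longrightarrow> z \<in> Qp p \<Longrightarrow>
    qp_dist p x y \<le> r \<Longrightarrow> qp_dist p y z \<le> r \<Longrightarrow> qp_dist p x z \<le> r"
  using qp_dist_triangle[of x y z] by linarith

lemma qp_dist_add_le:
  "x \<in> Qp p \<Longrightarrow> y \<in> Qp p \<Longrightarrow> x' \<in> Qp p \<Longrightarrow> y' \<in> Qp p \<Longrightarrow>
    qp_dist p x x' \<le> r \<Longrightarrow> qp_dist p y y' \<le> r \<Longrightarrow>
    qp_dist p (qp_add p x y) (qp_add p x' y') \<le> r"
  using qp_dist_add[of x y x' y'] by linarith

lemma qp_abs_add_le: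
  "x \<in> Qp p \<Longrightarrow> y \<in> Qp p \<Longrightarrow> qp_abs p x \<le> r \<Longrightarrow> qp_abs p y \<le> r \<Longrightarrow>
    qp_abs p (qp_add p x y) \<le> r"
  using qp_abs_add[of x y] by linarith

lemma qp_abs_le_if_dist_le:
  "x \<in> Qp p \<Longrightarrow> y \<in> Qp p \<Longrightarrow> qp_dist p x y \<le> r \<Longrightarrow> qp_abs p y \<le> r \<Longrightarrow> qp_abs p x \<le> r"
  using qp_abs_le_max_dist[of x y] by linarith

lemma vadd_in_QpN [simp]:
  assumes "\<xi> \<in> QpN p" "\<eta> \<in> QpN p"
  shows "vadd p \<xi> \<eta> \<in> QpN p"
proof -
  have "{i. qp_abs p (qp_add p (\<xi> i) (\<eta> i)) > 1} \<subseteq> {i. qp_abs p (\<xi> i) > 1} \<union> {i. qp_abs p (\<eta> i) > 1}"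
    using qp_abs_add_le[of "\<xi> _" "\<eta> _" 1] assms by (auto simp flip: linorder_not_le)
  then have "finite {i. qp_abs p (qp_add p (\<xi> i) (\<eta> i)) > 1}"
    using assms QpN_finite finite_subset by blast
  then show ?thesis using assms by (intro QpNI) (auto simp: vadd_def)
qed

lemma vneg_in_QpN [simp]: "\<xi> \<in> QpN p \<Longrightarrow> vneg p \<xi> \<in> QpN p"
  using QpN_finite by (intro QpNI) (auto simp: vneg_def)

lemma vadd_apply: "vadd p \<xi> \<eta> i = qp_add p (\<xi> i) (\<eta> i)"
  by (simp add: vadd_def)

lemma vneg_apply: "vneg p \<xi> i = qp_neg p (\<xi> i)"
  by (simp add: vneg_def)

lemma vsmul_apply: "vsmul p a \<xi> i = qp_mult p a (\<xi> i)"
  by (simp add: vsmul_def)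

lemma vadd_commute: "vadd p \<xi> \<eta> = vadd p \<eta> \<xi>"
  by (simp add: vadd_def qp_add_commute)

lemma vadd_assoc:
  "\<xi> \<in> QpN p \<Longrightarrow> \<eta> \<in> QpN p \<Longrightarrow> \<zeta> \<in> QpN p \<Longrightarrow>
    vadd p (vadd p \<xi> \<eta>) \<zeta> = vadd p \<xi> (vadd p \<eta> \<zeta>)"
  by (simp add: vadd_def qp_add_assoc)

lemma vadd_0 [simp]: "\<xi> \<in> QpN p \<Longrightarrow> vadd p \<xi> vzero = \<xi>"
  by (rule ext) (simp add: vadd_apply vneg_apply vzero_apply)

lemma vadd_neg [simp]: "\<xi> \<in> QpN p \<Longrightarrow> vadd p \<xi> (vneg p \<xi>) = vzero"
  by (rule ext) (simp add: vadd_apply vneg_apply vzero_apply)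

lemma vadd_diff_cancel [simp]:
  assumes "\<xi> \<in> QpN p" "\<eta> \<in> QpN p"
  shows "vadd p \<eta> (vadd p \<xi> (vneg p \<eta>)) = \<xi>"
proof -
  have "vadd p \<eta> (vadd p \<xi> (vneg p \<eta>)) = vadd p (vadd p \<xi> (vneg p \<eta>)) \<eta>"
    by (rule vadd_commute)
  also have "\<dots> = vadd p \<xi> (vadd p (vneg p \<eta>) \<eta>)"
    using assms by (simp add: vadd_assoc)
  also have "\<dots> = vadd p \<xi> (vadd p \<eta> (vneg p \<eta>))"
    by (simp add: vadd_commute)
  finally show ?thesis using assms by simp
qed

lemma vadd_diff_cancel2 [simp]:
  assumes "\<xi> \<in> QpN p" "\<eta> \<in> QpN p"
  shows "vadd p (vadd p \<eta> \<xi>) (vneg p \<eta>) = \<xi>"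
  using assms vadd_diff_cancel[OF assms] by (simp add: vadd_assoc)

text \<open>Norm distance at most \<open>r\<close>, written by coordinates so that no supremum has
  to be shown bounded. For \<open>r = 1\<close> this is congruence modulo the unit ball.\<close>

definition vnear :: "real \<Rightarrow> qpN \<Rightarrow> qpN \<Rightarrow> bool" where
  "vnear r \<xi> \<eta> \<longleftrightarrow> (\<forall>i. qp_dist p (\<xi> i) (\<eta> i) \<le> r)"

lemma vnear_refl: "\<xi> \<in> QpN p \<Longrightarrow> r \<ge> 0 \<Longrightarrow> vnear r \<xi> \<xi>"
  by (simp add: vnear_def)

lemma vnear_sym: "\<xi> \<in> QpN p \<Longrightarrow> \<eta> \<in> QpN p \<Longrightarrow> vnear r \<xi> \<eta> \<Longrightarrow> vnear r \<eta> \<xi>"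
  by (simp add: vnear_def qp_dist_commute)

lemma vnear_trans:
  assumes "\<xi> \<in> QpN p" "\<eta> \<in> QpN p" "\<zeta> \<in> QpN p" "vnear r \<xi> \<eta>" "vnear r \<eta> \<zeta>"
  shows "vnear r \<xi> \<zeta>"
  unfolding vnear_def
proof
  fix i
  show "qp_dist p (\<xi> i) (\<zeta> i) \<le> r"
    using qp_dist_triangle_le[of "\<xi> i" "\<eta> i" "\<zeta> i"] assms by (simp add: vnear_def)
qed

lemma vnear_mono: "vnear r \<xi> \<eta> \<Longrightarrow> r \<le> s \<Longrightarrow> vnear s \<xi> \<eta>"
  unfolding vnear_def using order_trans by blast

lemma vnear_add:
  assumes "\<xi> \<in> QpN p" "\<eta> \<in> QpN p" "\<xi>' \<in> QpN p" "\<eta>' \<in> QpN p" "vnear r \<xi> \<xi>'" "vnear r \<eta> \<eta>'"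
  shows "vnear r (vadd p \<xi> \<eta>) (vadd p \<xi>' \<eta>')"
  unfolding vnear_def
proof
  fix i
  show "qp_dist p (vadd p \<xi> \<eta> i) (vadd p \<xi>' \<eta>' i) \<le> r"
    using qp_dist_add_le[of "\<xi> i" "\<eta> i" "\<xi>' i" "\<eta>' i"] assms by (simp add: vnear_def vadd_apply)
qed

lemma vnear_diff_iff:
  "vnear r (vadd p \<xi> (vneg p \<eta>)) vzero \<longleftrightarrow> vnear r \<xi> \<eta>" if "\<xi> \<in> QpN p" "\<eta> \<in> QpN p"
  using that by (simp add: vnear_def qp_dist_def vadd_apply vneg_apply vzero_apply)

lemma vnear_zero_iff: "\<xi> \<in> QpN p \<Longrightarrow> vnear r \<xi> vzero \<longleftrightarrow> (\<forall>i. qp_abs p (\<xi> i) \<le> r)"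
  by (simp add: vnear_def vzero_apply)

lemma bdd_above_qp_abs:
  assumes "\<xi> \<in> QpN p"
  shows "bdd_above (range (\<lambda>i. qp_abs p (\<xi> i)))"
proof -
  have "range (\<lambda>i. qp_abs p (\<xi> i)) \<subseteq> (\<lambda>i. qp_abs p (\<xi> i)) ` {i. qp_abs p (\<xi> i) > 1} \<union> {..1}"
    by auto
  moreover have "bdd_above ((\<lambda>i. qp_abs p (\<xi> i)) ` {i. qp_abs p (\<xi> i) > 1} \<union> {..1})"
    using QpN_finite[OF assms] by (simp add: bdd_above_finite)
  ultimately show ?thesis by (rule bdd_above_mono[rotated])
qed

lemma vnorm_le_iff:
  assumes "\<xi> \<in> QpN p"
  shows "vnorm p \<xi> \<le> r \<longleftrightarrow> vnear r \<xi> vzero"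
  unfolding vnorm_def vnear_zero_iff[OF assms]
  by (subst cSUP_le_iff[OF _ bdd_above_qp_abs[OF assms]]) auto

text \<open>A neighbourhood base of \<open>tau\<close> indexed by a single number: the difference
  lies in the unit ball, and its first \<open>n\<close> coordinates are divisible by p^n. The
  remaining coordinates are only integral, because \<open>tau\<close> is a product topology on each
  coset of the unit ball.\<close>

definition wnear :: "nat \<Rightarrow> qpN \<Rightarrow> qpN \<Rightarrow> bool" where
  "wnear n \<xi> \<eta> \<longleftrightarrow> vnear 1 \<xi> \<eta> \<and> (\<forall>i<n. qp_dist p (\<xi> i) (\<eta> i) \<le> 1 / real p ^ n)"

lemma wnearD: "wnear n \<xi> \<eta> \<Longrightarrow> vnear 1 \<xi> \<eta>" "wnear n \<xi> \<eta> \<Longrightarrow> i < n \<Longrightarrow> qp_dist p (\<xi> i) (\<eta> i) \<le> 1 / real p ^ n"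
  by (auto simp: wnear_def)

lemma inverse_p_power_antimono: "m \<le> n \<Longrightarrow> 1 / real p ^ n \<le> 1 / real p ^ m"
  using p_gt_1 by (intro divide_left_mono power_increasing) auto

lemma vnear_imp_wnear: "vnear (1 / real p ^ n) \<xi> \<eta> \<Longrightarrow> wnear n \<xi> \<eta>"
  using inverse_p_power_antimono[of 0 n] by (auto simp: wnear_def intro: vnear_mono) (simp add: vnear_def)

lemma wnear_refl: "\<xi> \<in> QpN p \<Longrightarrow> wnear n \<xi> \<xi>"
  using p_pos by (simp add: vnear_imp_wnear vnear_refl)

lemma wnear_trans:
  assumes "\<xi> \<in> QpN p" "\<eta> \<in> QpN p" "\<zeta> \<in> QpN p" "wnear n \<xi> \<eta>" "wnear n \<eta> \<zeta>"
  shows "wnear n \<xi> \<zeta>"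
  unfolding wnear_def
proof (intro conjI allI impI)
  show "vnear 1 \<xi> \<zeta>" using vnear_trans[of \<xi> \<eta> \<zeta>] assms by (simp add: wnear_def)
  fix i assume "i < n"
  then show "qp_dist p (\<xi> i) (\<zeta> i) \<le> 1 / real p ^ n"
    using qp_dist_triangle_le[of "\<xi> i" "\<eta> i" "\<zeta> i"] assms
    by (simp add: wnear_def)
qed

lemma wnear_add:
  assumes "\<xi> \<in> QpN p" "\<eta> \<in> QpN p" "\<xi>' \<in> QpN p" "\<eta>' \<in> QpN p" "wnear n \<xi> \<xi>'" "wnear n \<eta> \<eta>'"
  shows "wnear n (vadd p \<xi> \<eta>) (vadd p \<xi>' \<eta>')"
  unfolding wnear_def
proof (intro conjI allI impI)
  show "vnear 1 (vadd p \<xi> \<eta>) (vadd p \<xi>' \<eta>')" using vnear_add assms by (simp add: wnear_def)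
  fix i assume "i < n"
  then show "qp_dist p (vadd p \<xi> \<eta> i) (vadd p \<xi>' \<eta>' i) \<le> 1 / real p ^ n"
    using qp_dist_add_le[of "\<xi> i" "\<eta> i" "\<xi>' i" "\<eta>' i"] assms
    by (simp add: wnear_def vadd_apply)
qed

lemma wnear_mono: "wnear n \<xi> \<eta> \<Longrightarrow> m \<le> n \<Longrightarrow> wnear m \<xi> \<eta>"
  unfolding wnear_def by (meson inverse_p_power_antimono less_le_trans order_trans)

section \<open>Neighbourhoods and compact sets for the topology\<close>

lemma istopology_tau:
  "istopology (\<lambda>A. A \<subseteq> QpN p \<and>
      (\<forall>P. finite P \<longrightarrow> openin (subtopology (prod_top p) (XP p P)) (A \<inter> XP p P)))"
  (is "istopology ?L")
proof -
  have int: "?L (S \<inter> T)" if S: "?L S" and T: "?L T" for S T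
  proof -
    have "openin (subtopology (prod_top p) (XP p P)) (S \<inter> T \<inter> XP p P)" if P: "finite P" for P
    proof -
      have "S \<inter> T \<inter> XP p P = (S \<inter> XP p P) \<inter> (T \<inter> XP p P)" by blast
      then show ?thesis using S T P by (metis (no_types, lifting) openin_Int)
    qed
    then show ?thesis using S by blast
  qed
  have un: "?L (\<Union>\<K>)" if K: "\<forall>K\<in>\<K>. ?L K" for \<K>
  proof -
    have "openin (subtopology (prod_top p) (XP p P)) (\<Union>\<K> \<inter> XP p P)" if P: "finite P" for P
    proof -
      have "\<Union>\<K> \<inter> XP p P = \<Union>((\<lambda>K. K \<inter> XP p P) ` \<K>)" by blast
      then show ?thesis using K P by (simp only:) (rule openin_Union, blast)
    qed
    then show ?thesis using K by blast
  qed
  show ?thesis unfolding istopology_def using int un by blast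
qed

lemma openin_tau:
  "openin (tau p) A \<longleftrightarrow> A \<subseteq> QpN p \<and>
      (\<forall>P. finite P \<longrightarrow> openin (subtopology (prod_top p) (XP p P)) (A \<inter> XP p P))"
  unfolding tau_def using topology_inverse'[OF istopology_tau] by simp

lemma topspace_qp_top [simp]: "topspace (qp_top p) = Qp p"
  by (simp add: qp_top_eq)

text \<open>By the ultrametric inequality each \<open>XP p P\<close> is a union of cosets of the
  unit ball.\<close>

lemma in_XP_if_near:
  assumes "y \<in> XP p P" "z \<in> QpN p" "vnear 1 z y"
  shows "z \<in> XP p P"
proof -
  have y: "y \<in> QpN p" "\<And>j. j \<notin> P \<Longrightarrow> qp_abs p (y j) \<le> 1" using assms(1) by (auto simp: XP_def Zp_def)
  have "qp_abs p (z j) \<le> 1" if "j \<notin> P" for j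
    using qp_abs_le_if_dist_le[of "z j" "y j" 1] y(1) y(2)[OF that] assms(2,3) by (simp add: vnear_def)
  then show ?thesis using assms(2) by (auto simp: XP_def Zp_def)
qed

lemma in_XP_nonintegral: "y \<in> QpN p \<Longrightarrow> y \<in> XP p {j. qp_abs p (y j) > 1}"
  by (auto simp: XP_def Zp_def)

text \<open>Openness is tested on the piece belonging to the nonintegral coordinates of
  \<open>y\<close>. It contains the whole coset of \<open>y\<close> modulo the unit ball, so
  nearness does not leave it. A basic box constrains finitely many coordinates, and one
  \<open>n\<close> can serve them all.\<close>

lemma openin_tau_imp_wnear:
  assumes U: "openin (tau p) U" and y: "y \<in> U"
  shows "\<exists>n. \<forall>z\<in>QpN p. wnear n z y \<longrightarrow> z \<in> U"
proof -
  have yX: "y \<in> QpN p" using U y by (auto simp: openin_tau)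
  let ?P = "{j. qp_abs p (y j) > 1}"
  have "finite ?P" using yX by (rule QpN_finite)
  then have "openin (subtopology (prod_top p) (XP p ?P)) (U \<inter> XP p ?P)"
    using U by (simp add: openin_tau)
  then obtain T where T: "openin (prod_top p) T" "U \<inter> XP p ?P = T \<inter> XP p ?P"
    by (auto simp: openin_subtopology)
  have yP: "y \<in> XP p ?P" using in_XP_nonintegral[OF yX] .
  then have "y \<in> T" using T y by blast
  then obtain V where V: "finite {i. V i \<noteq> Qp p}" "\<And>i. openin (qp_top p) (V i)"
      "y \<in> Pi\<^sub>E UNIV V" "Pi\<^sub>E UNIV V \<subseteq> T"
    using T(1) unfolding prod_top_def openin_product_topology_alt by auto
  have "\<exists>k. \<forall>x\<in>Qp p. qp_dist p x (y i) \<le> 1 / real p ^ k \<longrightarrow> x \<in> V i" for i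
  proof -
    have "y i \<in> V i" using V(3) by auto
    then obtain r where r: "r > 0" "qpm.mball (y i) r \<subseteq> V i"
      using V(2)[of i] unfolding qp_top_eq qpm.openin_mtopology by blast
    obtain k where "1 / real p ^ k < r" using inverse_p_power_less[OF r(1)] .
    then have "\<forall>x\<in>Qp p. qp_dist p x (y i) \<le> 1 / real p ^ k \<longrightarrow> x \<in> V i"
      using r(2) yX by (auto simp: subset_iff qp_dist_commute)
    then show ?thesis by blast
  qed
  then obtain k where k: "\<And>i x. x \<in> Qp p \<Longrightarrow> qp_dist p x (y i) \<le> 1 / real p ^ k i \<Longrightarrow> x \<in> V i"
    by metis
  let ?F = "{i. V i \<noteq> Qp p}"
  \<comment> \<open>The sum exceeds every constrained index and is at least every exponent
    \<open>k i\<close>.\<close>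
  define n where "n = (\<Sum>i\<in>?F. Suc i + k i)"
  have n: "Suc i + k i \<le> n" if "i \<in> ?F" for i
    unfolding n_def using member_le_sum[of i ?F "\<lambda>i. Suc i + k i"] that V(1) by simp
  have "z \<in> U" if z: "z \<in> QpN p" "wnear n z y" for z
  proof -
    have "z i \<in> V i" for i
    proof (cases "i \<in> ?F")
      case True
      then have "i < n" "k i \<le> n" using n[OF True] by auto
      then have "qp_dist p (z i) (y i) \<le> 1 / real p ^ k i"
        using wnearD(2)[OF z(2)] inverse_p_power_antimono order_trans by blast
      then show ?thesis using k z by simp
    qed (use z in auto)
    then have "z \<in> T" using V(4) by (auto simp: PiE_def)
    moreover have "z \<in> XP p ?P" using in_XP_if_near[OF yP z(1)] wnearD(1)[OF z(2)] .
    ultimately show ?thesis using T by blast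
  qed
  then show ?thesis by blast
qed

lemma openin_tauI:
  assumes UX: "U \<subseteq> QpN p" and U: "\<And>y. y \<in> U \<Longrightarrow> \<exists>n. \<forall>z\<in>QpN p. wnear n z y \<longrightarrow> z \<in> U"
  shows "openin (tau p) U"
  unfolding openin_tau
proof (intro conjI allI impI UX)
  fix P :: "nat set" assume P: "finite P"
  show "openin (subtopology (prod_top p) (XP p P)) (U \<inter> XP p P)"
  proof (subst openin_subopen, intro ballI)
    fix y assume y: "y \<in> U \<inter> XP p P"
    then have yX: "y \<in> QpN p" using UX by blast
    obtain n where n: "\<And>z. z \<in> QpN p \<Longrightarrow> wnear n z y \<Longrightarrow> z \<in> U" using U y by blast
    \<comment> \<open>The box must reach beyond \<open>n\<close> and also cover \<open>P\<close>:
      coordinates in \<open>P\<close> are not bounded in advance, whereas outside \<open>P\<close>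
      both vectors are integral and differ by at most 1 anyway.\<close>
    obtain N where N: "\<And>i. i \<in> P \<Longrightarrow> i < N" "n \<le> N"
      using finite_nat_set_iff_bounded[of P] P by (metis le_cases less_le_trans)
    define V where "V i = (if i < N then qpm.mball (y i) (1 / real p ^ n) else Qp p)" for i
    let ?T = "Pi\<^sub>E UNIV V \<inter> XP p P"
    have "{i. V i \<noteq> Qp p} \<subseteq> {..<N}" by (auto simp: V_def)
    then have "finite {i. V i \<noteq> Qp p}" using finite_subset by blast
    moreover have "openin (qp_top p) (V i)" for i
      by (simp add: V_def qp_top_eq)
    ultimately have "openin (prod_top p) (Pi\<^sub>E UNIV V)"
      unfolding prod_top_def by (simp add: openin_PiE_gen)
    then have "openin (subtopology (prod_top p) (XP p P)) ?T"
      by (auto simp: openin_subtopology)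
    moreover have "y \<in> ?T" using y yX p_pos by (auto simp: V_def)
    moreover have "?T \<subseteq> U \<inter> XP p P"
    proof
      fix z assume z: "z \<in> ?T"
      have zX: "z \<in> QpN p" using z by (auto simp: XP_def)
      have V: "z i \<in> V i" for i using z by auto
      have small: "qp_dist p (z i) (y i) \<le> 1 / real p ^ n" if "i < N" for i
        using V[of i] that zX yX by (auto simp: V_def qp_dist_commute)
      have "qp_dist p (z i) (y i) \<le> 1" for i
      proof (cases "i < N")
        case True
        then show ?thesis using small[OF True] inverse_p_power_antimono[of 0 n] by simp
      next
        case False
        then have "i \<notin> P" using N by blast
        then have "qp_abs p (z i) \<le> 1" "qp_abs p (y i) \<le> 1" using z y by (auto simp: XP_def Zp_def)
        then show ?thesis
          using qp_abs_add[of "z i" "qp_neg p (y i)"] zX yX by (auto simp: qp_dist_def)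
      qed
      then have "wnear n z y" using small N by (auto simp: wnear_def vnear_def)
      then show "z \<in> U \<inter> XP p P" using n zX z by auto
    qed
    ultimately show "\<exists>T. openin (subtopology (prod_top p) (XP p P)) T \<and> y \<in> T \<and> T \<subseteq> U \<inter> XP p P"
      by blast
  qed
qed

lemma topspace_tau [simp]: "topspace (tau p) = QpN p"
proof (rule antisym)
  show "topspace (tau p) \<subseteq> QpN p" using openin_tau openin_topspace by blast
  have "openin (tau p) (QpN p)" by (rule openin_tauI) auto
  then show "QpN p \<subseteq> topspace (tau p)" by (rule openin_subset)
qed

lemma openin_tau_wnear: "y \<in> QpN p \<Longrightarrow> openin (tau p) {z \<in> QpN p. wnear n z y}"
  by (rule openin_tauI) (use wnear_trans in blast)+

lemma wnear_0_iff: "wnear 0 \<xi> \<eta> \<longleftrightarrow> vnear 1 \<xi> \<eta>"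
  by (simp add: wnear_def)

lemma openin_tau_unit_coset: "y \<in> QpN p \<Longrightarrow> openin (tau p) {z \<in> QpN p. vnear 1 z y}"
  using openin_tau_wnear[of y 0] by (simp add: wnear_0_iff)

lemma closedin_tau_unit_coset:
  assumes y: "y \<in> QpN p"
  shows "closedin (tau p) {z \<in> QpN p. vnear 1 z y}"
proof -
  have "openin (tau p) {z \<in> QpN p. \<not> vnear 1 z y}"
  proof (rule openin_tauI)
    fix x assume x: "x \<in> {z \<in> QpN p. \<not> vnear 1 z y}"
    have "\<not> vnear 1 z y" if "z \<in> QpN p" "wnear 0 z x" for z
    proof -
      have "vnear 1 x z" using that x by (auto simp: wnear_0_iff vnear_sym)
      then show ?thesis using vnear_trans[of x z y 1] x y that by blast
    qed
    then show "\<exists>n. \<forall>z\<in>QpN p. wnear n z x \<longrightarrow> z \<in> {z \<in> QpN p. \<not> vnear 1 z y}" by blast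
  qed auto
  moreover have "topspace (tau p) - {z \<in> QpN p. vnear 1 z y} = {z \<in> QpN p. \<not> vnear 1 z y}"
    by auto
  ultimately show ?thesis by (simp add: closedin_def)
qed

lemma XP_empty: "XP p {} = Pi\<^sub>E UNIV (\<lambda>i. Zp p)"
proof -
  have "\<xi> \<in> XP p {}" if "\<xi> \<in> Pi\<^sub>E UNIV (\<lambda>i. Zp p)" for \<xi>
  proof -
    have "\<xi> i \<in> Zp p" for i using that by auto
    then have "\<And>i. \<xi> i \<in> Qp p" "\<And>i. \<not> 1 < qp_abs p (\<xi> i)" by (auto simp: Zp_def not_less)
    then have "\<xi> \<in> QpN p" by (intro QpNI) auto
    then show ?thesis using that by (auto simp: XP_def)
  qed
  then show ?thesis by (auto simp: XP_def)
qed

lemma XP_empty_unit_ball: "XP p {} = {z \<in> QpN p. vnear 1 z vzero}"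
  by (auto simp: XP_def Zp_def vnear_zero_iff)

text \<open>\<open>XP p {}\<close> is a full product of copies of Z_p, compact by Tychonoff's
  theorem. Testing \<open>tau\<close>-open sets on this very piece shows that the inclusion is
  continuous from the product topology, and compactness is carried over.\<close>

lemma compactin_tau_unit_ball: "compactin (tau p) {z \<in> QpN p. vnear 1 z vzero}"
proof -
  have "compactin (prod_top p) (XP p {})"
    unfolding prod_top_def XP_empty by (simp add: compactin_PiE compactin_Zp)
  then have "compactin (subtopology (prod_top p) (XP p {})) (XP p {})"
    by (simp add: compactin_subtopology)
  moreover have "continuous_map (subtopology (prod_top p) (XP p {})) (tau p) (\<lambda>x. x)"
    unfolding continuous_map_def
  proof (intro conjI allI impI)
    show "(\<lambda>x. x) \<in> topspace (subtopology (prod_top p) (XP p {})) \<rightarrow> topspace (tau p)"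
      by (auto simp: XP_def)
    fix U assume U: "openin (tau p) U"
    have "{x \<in> topspace (subtopology (prod_top p) (XP p {})). x \<in> U} = U \<inter> XP p {}"
      by (auto simp: prod_top_def XP_def)
    then show "openin (subtopology (prod_top p) (XP p {}))
        {x \<in> topspace (subtopology (prod_top p) (XP p {})). x \<in> U}"
      using U by (simp add: openin_tau)
  qed
  ultimately have "compactin (tau p) ((\<lambda>x. x) ` XP p {})" by (rule image_compactin)
  then show ?thesis by (simp add: XP_empty_unit_ball)
qed

lemma wnear_diff_iff:
  "wnear n (vadd p \<xi> (vneg p \<eta>)) vzero \<longleftrightarrow> wnear n \<xi> \<eta>" if "\<xi> \<in> QpN p" "\<eta> \<in> QpN p"
  using that by (simp add: wnear_def vnear_def qp_dist_def vadd_apply vneg_apply vzero_apply)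

lemma continuous_map_tauI:
  assumes f: "f \<in> QpN p \<rightarrow> QpN p"
    and cont: "\<And>x n. x \<in> QpN p \<Longrightarrow> \<exists>m. \<forall>z\<in>QpN p. wnear m z x \<longrightarrow> wnear n (f z) (f x)"
  shows "continuous_map (tau p) (tau p) f"
  unfolding continuous_map_def
proof (intro conjI allI impI)
  show "f \<in> topspace (tau p) \<rightarrow> topspace (tau p)" using f by simp
  fix U assume U: "openin (tau p) U"
  show "openin (tau p) {x \<in> topspace (tau p). f x \<in> U}"
  proof (rule openin_tauI)
    fix y assume y: "y \<in> {x \<in> topspace (tau p). f x \<in> U}"
    then obtain n where n: "\<forall>z\<in>QpN p. wnear n z (f y) \<longrightarrow> z \<in> U"
      using openin_tau_imp_wnear[OF U] by blast
    obtain m where "\<forall>z\<in>QpN p. wnear m z y \<longrightarrow> wnear n (f z) (f y)" using cont[of y n] y by auto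
    then show "\<exists>n. \<forall>z\<in>QpN p. wnear n z y \<longrightarrow> z \<in> {x \<in> topspace (tau p). f x \<in> U}"
      using n f by (intro exI[of _ m]) auto
  qed auto
qed

lemma compactin_tau_unit_coset:
  assumes y: "y \<in> QpN p"
  shows "compactin (tau p) {z \<in> QpN p. vnear 1 z y}"
proof -
  have "continuous_map (tau p) (tau p) (vadd p y)"
  proof (rule continuous_map_tauI)
    fix x n assume "x \<in> QpN p"
    then have "\<forall>z\<in>QpN p. wnear n z x \<longrightarrow> wnear n (vadd p y z) (vadd p y x)"
      using wnear_add[of y _ y x n] y by (simp add: wnear_refl)
    then show "\<exists>m. \<forall>z\<in>QpN p. wnear m z x \<longrightarrow> wnear n (vadd p y z) (vadd p y x)" by blast
  qed (use y in simp)
  then have "compactin (tau p) (vadd p y ` {z \<in> QpN p. vnear 1 z vzero})"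
    using compactin_tau_unit_ball image_compactin by blast
  moreover have "vadd p y ` {z \<in> QpN p. vnear 1 z vzero} = {z \<in> QpN p. vnear 1 z y}" (is "?L = ?R")
  proof (intro equalityI subsetI)
    fix z assume "z \<in> ?L"
    then obtain u where u: "u \<in> QpN p" "vnear 1 u vzero" "z = vadd p y u" by blast
    then show "z \<in> ?R" using vnear_add[of y u y vzero 1] y by (auto simp: vnear_refl)
  next
    fix z assume z: "z \<in> ?R"
    then have "vadd p z (vneg p y) \<in> {z \<in> QpN p. vnear 1 z vzero}"
      using y by (simp add: vnear_diff_iff)
    moreover have "z = vadd p y (vadd p z (vneg p y))" using z y by simp
    ultimately show "z \<in> ?L" by blast
  qed
  ultimately show ?thesis by simp
qed

text \<open>One direction covers the closure by cosets of the unit ball, which are open. The other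
  uses that a finite union of cosets is closed and compact, hence contains the closure as a closed
  subset of a compact set.\<close>

lemma compactin_closure_iff:
  assumes S: "S \<subseteq> QpN p"
  shows "compactin (tau p) (tau p closure_of S) \<longleftrightarrow>
    (\<exists>F. finite F \<and> F \<subseteq> QpN p \<and> (\<forall>s\<in>S. \<exists>f\<in>F. vnear 1 s f))"
proof
  let ?c = "\<lambda>f. {z \<in> QpN p. vnear 1 z f}"
  assume "compactin (tau p) (tau p closure_of S)"
  moreover have "tau p closure_of S \<subseteq> \<Union>(?c ` QpN p)"
  proof
    fix x assume "x \<in> tau p closure_of S"
    then have "x \<in> QpN p" using closure_of_subset_topspace[of "tau p" S] by auto
    then show "x \<in> \<Union>(?c ` QpN p)" using vnear_refl[of x 1] by auto
  qed
  moreover have "\<forall>U\<in>?c ` QpN p. openin (tau p) U" using openin_tau_unit_coset by blast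
  ultimately obtain \<F> where F: "finite \<F>" "\<F> \<subseteq> ?c ` QpN p" "tau p closure_of S \<subseteq> \<Union>\<F>"
    unfolding compactin_def by meson
  then obtain F where F': "finite F" "F \<subseteq> QpN p" "\<F> = ?c ` F" by (meson finite_subset_image)
  have "S \<subseteq> \<Union>(?c ` F)" using closure_of_subset[of S "tau p"] S F F' by simp
  then have "\<forall>s\<in>S. \<exists>f\<in>F. vnear 1 s f" by auto
  then show "\<exists>F. finite F \<and> F \<subseteq> QpN p \<and> (\<forall>s\<in>S. \<exists>f\<in>F. vnear 1 s f)"
    using F'(1,2) by blast
next
  let ?c = "\<lambda>f. {z \<in> QpN p. vnear 1 z f}"
  assume "\<exists>F. finite F \<and> F \<subseteq> QpN p \<and> (\<forall>s\<in>S. \<exists>f\<in>F. vnear 1 s f)"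
  then obtain F where F: "finite F" "F \<subseteq> QpN p" and "\<forall>s\<in>S. \<exists>f\<in>F. vnear 1 s f" by blast
  then have SF: "S \<subseteq> \<Union>(?c ` F)" using S by fastforce
  have C: "compactin (tau p) (\<Union>(?c ` F))"
    using F compactin_tau_unit_coset by (intro compactin_Union) auto
  have D: "closedin (tau p) (\<Union>(?c ` F))"
    using F closedin_tau_unit_coset by (intro closedin_Union) auto
  show "compactin (tau p) (tau p closure_of S)"
    by (rule closed_compactin[OF C closure_of_minimal[OF SF D] closedin_closure_of])
qed

section \<open>Linear maps, their continuity, norm and compactness\<close>

lemma qp_neg_add: "x \<in> Qp p \<Longrightarrow> y \<in> Qp p \<Longrightarrow> qp_neg p (qp_add p x y) = qp_add p (qp_neg p x) (qp_neg p y)"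
  by (elim Qp_cases) (simp add: qp_add_class qp_neg_class)

lemma qp_mult_neg: "a \<in> Qp p \<Longrightarrow> x \<in> Qp p \<Longrightarrow> qp_mult p a (qp_neg p x) = qp_neg p (qp_mult p a x)"
  by (elim Qp_cases) (simp add: qp_mult_class qp_neg_class)

lemma Zp_in_Qp: "a \<in> Zp p \<Longrightarrow> a \<in> Qp p"
  by (simp add: Zp_def)

lemma vsmul_in_QpN [simp]:
  assumes "a \<in> Zp p" "\<xi> \<in> QpN p"
  shows "vsmul p a \<xi> \<in> QpN p"
proof (rule QpNI)
  have a: "a \<in> Qp p" "qp_abs p a \<le> 1" using assms(1) by (auto simp: Zp_def)
  show "vsmul p a \<xi> i \<in> Qp p" for i using a assms by (simp add: vsmul_apply)
  have "qp_abs p (vsmul p a \<xi> i) \<le> qp_abs p (\<xi> i)" for i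
    using a assms(2) mult_right_mono[of "qp_abs p a" 1 "qp_abs p (\<xi> i)"]
    by (simp add: vsmul_apply qp_abs_mult qp_abs_nonneg)
  then have "{i. qp_abs p (vsmul p a \<xi> i) > 1} \<subseteq> {i. qp_abs p (\<xi> i) > 1}"
    by (auto intro: less_le_trans)
  then show "finite {i. qp_abs p (vsmul p a \<xi> i) > 1}"
    using QpN_finite[OF assms(2)] finite_subset by blast
qed

lemma vsmul_add: "a \<in> Zp p \<Longrightarrow> \<xi> \<in> QpN p \<Longrightarrow> \<eta> \<in> QpN p \<Longrightarrow>
    vsmul p a (vadd p \<xi> \<eta>) = vadd p (vsmul p a \<xi>) (vsmul p a \<eta>)"
  by (rule ext) (simp add: vadd_apply vneg_apply vsmul_apply qp_mult_add Zp_in_Qp)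

lemma vsmul_neg: "a \<in> Zp p \<Longrightarrow> \<xi> \<in> QpN p \<Longrightarrow> vsmul p a (vneg p \<xi>) = vneg p (vsmul p a \<xi>)"
  by (rule ext) (simp add: vadd_apply vneg_apply vsmul_apply qp_mult_neg Zp_in_Qp)

lemma vneg_add: "\<xi> \<in> QpN p \<Longrightarrow> \<eta> \<in> QpN p \<Longrightarrow> vneg p (vadd p \<xi> \<eta>) = vadd p (vneg p \<xi>) (vneg p \<eta>)"
  by (rule ext) (simp add: vadd_apply vneg_apply vsmul_apply qp_neg_add)

lemma vnear_neg: "\<xi> \<in> QpN p \<Longrightarrow> \<eta> \<in> QpN p \<Longrightarrow> vnear r (vneg p \<xi>) (vneg p \<eta>) \<longleftrightarrow> vnear r \<xi> \<eta>"
  by (simp add: vnear_def qp_dist_neg vneg_apply)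

lemma wnear_neg: "\<xi> \<in> QpN p \<Longrightarrow> \<eta> \<in> QpN p \<Longrightarrow> wnear n (vneg p \<xi>) (vneg p \<eta>) \<longleftrightarrow> wnear n \<xi> \<eta>"
  by (simp add: wnear_def vnear_neg qp_dist_neg vneg_apply)

lemma vadd_interchange:
  assumes "a \<in> QpN p" "b \<in> QpN p" "c \<in> QpN p" "d \<in> QpN p"
  shows "vadd p (vadd p a b) (vadd p c d) = vadd p (vadd p a c) (vadd p b d)"
proof -
  have "vadd p b (vadd p c d) = vadd p c (vadd p b d)"
    using assms vadd_assoc[of b c d] vadd_assoc[of c b d] vadd_commute[of b c] by simp
  then show ?thesis using assms by (simp add: vadd_assoc)
qed

text \<open>Extensionality is left out on purpose, since pointwise sums and powers
  \<open>a ^^ n\<close> need not have it; operators are restricted to \<open>QpN p\<close> only when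
  membership in \<open>A\<close> or \<open>B1 p\<close> is at stake.\<close>

definition vlinear :: "(qpN \<Rightarrow> qpN) \<Rightarrow> bool" where
  "vlinear T \<longleftrightarrow> T \<in> QpN p \<rightarrow> QpN p \<and>
     (\<forall>\<xi>\<in>QpN p. \<forall>\<eta>\<in>QpN p. T (vadd p \<xi> \<eta>) = vadd p (T \<xi>) (T \<eta>)) \<and>
     (\<forall>a\<in>Zp p. \<forall>\<xi>\<in>QpN p. T (vsmul p a \<xi>) = vsmul p a (T \<xi>))"

lemma vlinear_in [simp]: "vlinear T \<Longrightarrow> \<xi> \<in> QpN p \<Longrightarrow> T \<xi> \<in> QpN p"
  by (auto simp: vlinear_def)

lemma vlinear_add: "vlinear T \<Longrightarrow> \<xi> \<in> QpN p \<Longrightarrow> \<eta> \<in> QpN p \<Longrightarrow> T (vadd p \<xi> \<eta>) = vadd p (T \<xi>) (T \<eta>)"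
  by (auto simp: vlinear_def)

lemma vlinear_smul: "vlinear T \<Longrightarrow> a \<in> Zp p \<Longrightarrow> \<xi> \<in> QpN p \<Longrightarrow> T (vsmul p a \<xi>) = vsmul p a (T \<xi>)"
  by (auto simp: vlinear_def)

lemma vlinear_zero [simp]:
  assumes "vlinear T"
  shows "T vzero = vzero"
proof -
  have "vadd p (T vzero) (T vzero) = T vzero"
    using vlinear_add[OF assms, of vzero vzero] by simp
  then show ?thesis using vadd_diff_cancel2[of "T vzero" "T vzero"] assms by simp
qed

lemma vlinear_neg:
  assumes T: "vlinear T" and \<xi>: "\<xi> \<in> QpN p"
  shows "T (vneg p \<xi>) = vneg p (T \<xi>)"
proof -
  have "vadd p (T \<xi>) (T (vneg p \<xi>)) = vzero"
    using vlinear_add[OF T \<xi>, of "vneg p \<xi>"] T \<xi> by simp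
  then have "T (vneg p \<xi>) = vadd p vzero (vneg p (T \<xi>))"
    using vadd_diff_cancel2[of "T (vneg p \<xi>)" "T \<xi>"] T \<xi> by simp
  then show ?thesis using T \<xi> by (simp add: vadd_commute[of vzero])
qed

lemma vlinear_diff:
  assumes "vlinear T" "\<xi> \<in> QpN p" "\<eta> \<in> QpN p"
  shows "T (vadd p \<xi> (vneg p \<eta>)) = vadd p (T \<xi>) (vneg p (T \<eta>))"
  using assms by (simp add: vlinear_add vlinear_neg)

lemma vlinear_plus: "vlinear T \<Longrightarrow> vlinear S \<Longrightarrow> vlinear (\<lambda>\<xi>. vadd p (T \<xi>) (S \<xi>))"
  unfolding vlinear_def[of "\<lambda>\<xi>. vadd p (T \<xi>) (S \<xi>)"]
  by (auto simp: vlinear_add vlinear_smul vsmul_add vadd_interchange)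

lemma vlinear_minus: "vlinear T \<Longrightarrow> vlinear (\<lambda>\<xi>. vneg p (T \<xi>))"
  unfolding vlinear_def[of "\<lambda>\<xi>. vneg p (T \<xi>)"]
  by (auto simp: vlinear_add vlinear_smul vsmul_neg vneg_add)

lemma vlinear_comp: "vlinear T \<Longrightarrow> vlinear S \<Longrightarrow> vlinear (\<lambda>\<xi>. T (S \<xi>))"
  unfolding vlinear_def[of "\<lambda>\<xi>. T (S \<xi>)"]
  by (auto simp: vlinear_add vlinear_smul)

lemma vlinear_cong: "vlinear T \<Longrightarrow> (\<And>\<xi>. \<xi> \<in> QpN p \<Longrightarrow> T \<xi> = S \<xi>) \<Longrightarrow> vlinear S"
  by (simp add: vlinear_def Pi_iff)

text \<open>Continuity at zero in terms of the neighbourhood base; \<open>Bop_iff\<close> identifies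
  it with continuity for linear maps.\<close>

definition vcont0 :: "(qpN \<Rightarrow> qpN) \<Rightarrow> bool" where
  "vcont0 T \<longleftrightarrow> (\<forall>n. \<exists>m. \<forall>z\<in>QpN p. wnear m z vzero \<longrightarrow> wnear n (T z) vzero)"

lemma vcont0_plus:
  assumes "vlinear T" "vcont0 T" "vlinear S" "vcont0 S"
  shows "vcont0 (\<lambda>\<xi>. vadd p (T \<xi>) (S \<xi>))"
  unfolding vcont0_def
proof
  fix n
  obtain m1 where m1: "\<forall>z\<in>QpN p. wnear m1 z vzero \<longrightarrow> wnear n (T z) vzero"
    using assms(2) unfolding vcont0_def by blast
  obtain m2 where m2: "\<forall>z\<in>QpN p. wnear m2 z vzero \<longrightarrow> wnear n (S z) vzero"
    using assms(4) unfolding vcont0_def by blast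
  have "wnear n (vadd p (T z) (S z)) vzero" if z: "z \<in> QpN p" "wnear (max m1 m2) z vzero" for z
  proof -
    have "wnear m1 z vzero" "wnear m2 z vzero" using z wnear_mono by (meson max.cobounded1 max.cobounded2)+
    then have "wnear n (T z) vzero" "wnear n (S z) vzero" using m1 m2 z by auto
    then show ?thesis using wnear_add[of "T z" "S z" vzero vzero n] assms z by simp
  qed
  then show "\<exists>m. \<forall>z\<in>QpN p. wnear m z vzero \<longrightarrow> wnear n (vadd p (T z) (S z)) vzero" by blast
qed

lemma vcont0_minus:
  assumes "vlinear T" "vcont0 T"
  shows "vcont0 (\<lambda>\<xi>. vneg p (T \<xi>))"
proof -
  have "vneg p vzero = vzero" by (rule ext) (simp add: vneg_apply vzero_apply)
  then have "wnear n (vneg p (T z)) vzero \<longleftrightarrow> wnear n (T z) vzero" if "z \<in> QpN p" for z n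
    using wnear_neg[of "T z" vzero n] assms that by simp
  then show ?thesis using assms(2) unfolding vcont0_def by simp
qed

lemma vcont0_comp:
  assumes "vlinear S" "vcont0 T" "vcont0 S"
  shows "vcont0 (\<lambda>\<xi>. T (S \<xi>))"
  unfolding vcont0_def
proof
  fix n
  obtain m where m: "\<forall>z\<in>QpN p. wnear m z vzero \<longrightarrow> wnear n (T z) vzero"
    using assms(2) unfolding vcont0_def by blast
  obtain l where l: "\<forall>z\<in>QpN p. wnear l z vzero \<longrightarrow> wnear m (S z) vzero"
    using assms(3) unfolding vcont0_def by blast
  show "\<exists>m. \<forall>z\<in>QpN p. wnear m z vzero \<longrightarrow> wnear n (T (S z)) vzero"
    using m l assms(1) by (intro exI[of _ l]) auto
qed

text \<open>Neighbourhoods of a point are translates of those of zero, so for an additive map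
  continuity at zero gives continuity everywhere.\<close>

lemma Bop_iff: "T \<in> Bop p \<longleftrightarrow> T \<in> extensional (QpN p) \<and> vlinear T \<and> vcont0 T"
proof
  assume T: "T \<in> Bop p"
  then have lin: "vlinear T" and ext: "T \<in> extensional (QpN p)"
    and cont: "continuous_map (tau p) (tau p) T" by (auto simp: Bop_def vlinear_def)
  have "vcont0 T"
    unfolding vcont0_def
  proof
    fix n
    have "openin (tau p) {x \<in> QpN p. T x \<in> {z \<in> QpN p. wnear n z vzero}}"
      using openin_continuous_map_preimage[OF cont openin_tau_wnear[OF vzero_in_QpN]] by simp
    moreover have "vzero \<in> {x \<in> QpN p. T x \<in> {z \<in> QpN p. wnear n z vzero}}"
      using lin by (simp add: wnear_refl)
    ultimately have "\<exists>m. \<forall>z\<in>QpN p. wnear m z vzero \<longrightarrow>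
        z \<in> {x \<in> QpN p. T x \<in> {z \<in> QpN p. wnear n z vzero}}"
      by (rule openin_tau_imp_wnear)
    then show "\<exists>m. \<forall>z\<in>QpN p. wnear m z vzero \<longrightarrow> wnear n (T z) vzero" by auto
  qed
  then show "T \<in> extensional (QpN p) \<and> vlinear T \<and> vcont0 T" using lin ext by blast
next
  assume T: "T \<in> extensional (QpN p) \<and> vlinear T \<and> vcont0 T"
  have "continuous_map (tau p) (tau p) T"
  proof (rule continuous_map_tauI)
    show "T \<in> QpN p \<rightarrow> QpN p" using T by (simp add: vlinear_def)
    fix x n assume x: "x \<in> QpN p"
    obtain m where m: "\<forall>z\<in>QpN p. wnear m z vzero \<longrightarrow> wnear n (T z) vzero"
      using T unfolding vcont0_def by blast
    have "wnear n (T z) (T x)" if z: "z \<in> QpN p" "wnear m z x" for z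
    proof -
      have "wnear n (T (vadd p z (vneg p x))) vzero" using m z x by (simp add: wnear_diff_iff)
      then show ?thesis using T z x by (simp add: vlinear_diff wnear_diff_iff)
    qed
    then show "\<exists>m. \<forall>z\<in>QpN p. wnear m z x \<longrightarrow> wnear n (T z) (T x)" by blast
  qed
  then show "T \<in> Bop p" using T by (auto simp: Bop_def vlinear_def)
qed

lemma vcont0_cong: "vcont0 T \<Longrightarrow> (\<And>\<xi>. \<xi> \<in> QpN p \<Longrightarrow> T \<xi> = S \<xi>) \<Longrightarrow> vcont0 S"
  by (simp add: vcont0_def)

lemma restrict_in_Bop:
  assumes "vlinear T" "vcont0 T"
  shows "restrict T (QpN p) \<in> Bop p"
  using vlinear_cong[OF assms(1), of "restrict T (QpN p)"] vcont0_cong[OF assms(2), of "restrict T (QpN p)"]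
  by (simp add: Bop_iff)

definition vcontr :: "(qpN \<Rightarrow> qpN) \<Rightarrow> bool" where
  "vcontr T \<longleftrightarrow> (\<forall>\<xi>\<in>QpN p. vnear 1 \<xi> vzero \<longrightarrow> vnear 1 (T \<xi>) vzero)"

lemma B1_iff: "T \<in> B1 p \<longleftrightarrow> T \<in> extensional (QpN p) \<and> vlinear T \<and> vcont0 T \<and> vcontr T"
  unfolding B1_def vcontr_def by (auto simp: Bop_iff vnorm_le_iff)

text \<open>Compactness of an operator without topology, see \<open>Kop_iff\<close>. Radii p^n are
  enough because every norm-bounded set lies in such a ball.\<close>

definition vfinrange :: "(qpN \<Rightarrow> qpN) \<Rightarrow> bool" where
  "vfinrange T \<longleftrightarrow> (\<forall>n. \<exists>F. finite F \<and> F \<subseteq> QpN p \<and>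
     (\<forall>\<xi>\<in>QpN p. vnear (real p ^ n) \<xi> vzero \<longrightarrow> (\<exists>f\<in>F. vnear 1 (T \<xi>) f)))"

lemma Kop_iff:
  assumes T: "T \<in> Bop p"
  shows "T \<in> Kop p \<longleftrightarrow> vfinrange T"
proof -
  have lin: "vlinear T" using T by (simp add: Bop_iff)
  have im: "T ` B \<subseteq> QpN p" if "B \<subseteq> QpN p" for B using lin that by auto
  show ?thesis
  proof
    assume K: "T \<in> Kop p"
    show "vfinrange T"
      unfolding vfinrange_def
    proof
      fix n
      let ?B = "{\<xi> \<in> QpN p. vnear (real p ^ n) \<xi> vzero}"
      have B: "?B \<subseteq> QpN p" by blast
      have "\<forall>\<xi>\<in>?B. vnorm p \<xi> \<le> real p ^ n" by (simp add: vnorm_le_iff)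
      then have "\<exists>r. \<forall>\<xi>\<in>?B. vnorm p \<xi> \<le> r" by (rule exI)
      then have "compactin (tau p) (tau p closure_of (T ` ?B))"
        using K B by (simp add: Kop_def)
      then obtain F where "finite F" "F \<subseteq> QpN p" "\<forall>s\<in>T ` ?B. \<exists>f\<in>F. vnear 1 s f"
        unfolding compactin_closure_iff[OF im[OF B]] by blast
      then show "\<exists>F. finite F \<and> F \<subseteq> QpN p \<and>
          (\<forall>\<xi>\<in>QpN p. vnear (real p ^ n) \<xi> vzero \<longrightarrow> (\<exists>f\<in>F. vnear 1 (T \<xi>) f))"
        by (intro exI[of _ F]) simp
    qed
  next
    assume fin: "vfinrange T"
    have "compactin (tau p) (tau p closure_of (T ` B))"
      if B: "B \<subseteq> QpN p" and r: "\<forall>\<xi>\<in>B. vnorm p \<xi> \<le> r" for B r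
    proof -
      obtain n where n: "r < real p ^ n" using real_arch_pow[OF p_gt_1] by blast
      have "\<exists>F. finite F \<and> F \<subseteq> QpN p \<and>
          (\<forall>\<xi>\<in>QpN p. vnear (real p ^ n) \<xi> vzero \<longrightarrow> (\<exists>f\<in>F. vnear 1 (T \<xi>) f))"
        using fin unfolding vfinrange_def by (rule spec)
      then obtain F where F: "finite F" "F \<subseteq> QpN p"
          "\<And>\<xi>. \<xi> \<in> QpN p \<Longrightarrow> vnear (real p ^ n) \<xi> vzero \<Longrightarrow> \<exists>f\<in>F. vnear 1 (T \<xi>) f"
        by blast
      have "\<exists>f\<in>F. vnear 1 (T \<xi>) f" if "\<xi> \<in> B" for \<xi>
      proof (rule F(3))
        show X: "\<xi> \<in> QpN p" using B that by blast
        have "vnorm p \<xi> \<le> real p ^ n" using r that n by fastforce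
        then show "vnear (real p ^ n) \<xi> vzero" by (simp add: vnorm_le_iff X)
      qed
      then have "\<forall>s\<in>T ` B. \<exists>f\<in>F. vnear 1 s f" by blast
      then show ?thesis using compactin_closure_iff[OF im[OF B]] F(1,2) by blast
    qed
    then show "T \<in> Kop p" using T unfolding Kop_def by blast
  qed
qed

lemma K1_iff: "T \<in> K1 p \<longleftrightarrow> T \<in> B1 p \<and> vfinrange T"
  using Kop_iff[of T] by (auto simp: K1_def B1_def)

section \<open>Estimates under scaling by powers of p\<close>

lemma vsmul_p_power:
  assumes "\<xi> \<in> QpN p"
  shows "vnear r (vsmul p (qp_const (of_nat p ^ m)) \<xi>) vzero \<longleftrightarrow> vnear (r * real p ^ m) \<xi> vzero"
proof -
  have "1 / real p ^ m * x \<le> r \<longleftrightarrow> x \<le> r * real p ^ m" for x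
    using p_pos by (simp add: field_simps)
  then show ?thesis
    using assms by (simp add: vnear_def vzero_apply vsmul_apply qp_abs_mult padic_abs_p_power)
qed

lemma qp_const_p_power_in_Zp: "qp_const (of_nat p ^ m) \<in> Zp p"
  using inverse_p_power_antimono[of 0 m] by (simp add: Zp_def padic_abs_p_power)

text \<open>Scaling outwards is harmless: p^m carries the ball of radius p^m into the unit ball, and
  linearity brings the bound back. Only multiplication by p^m is applied to vectors.\<close>

lemma vlinear_bound_scale:
  assumes T: "vlinear T" and r: "\<And>\<xi>. \<xi> \<in> QpN p \<Longrightarrow> vnear 1 \<xi> vzero \<Longrightarrow> vnear r (T \<xi>) vzero"
    and \<xi>: "\<xi> \<in> QpN p" "vnear (real p ^ m) \<xi> vzero"
  shows "vnear (r * real p ^ m) (T \<xi>) vzero"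
proof -
  let ?c = "qp_const (of_nat p ^ m)"
  have "vnear 1 (vsmul p ?c \<xi>) vzero" using \<xi> by (simp add: vsmul_p_power)
  then have "vnear r (T (vsmul p ?c \<xi>)) vzero"
    using r \<xi> qp_const_p_power_in_Zp by simp
  then have "vnear r (vsmul p ?c (T \<xi>)) vzero"
    using vlinear_smul[OF T qp_const_p_power_in_Zp \<xi>(1)] by simp
  then show ?thesis using T \<xi> by (simp add: vsmul_p_power)
qed

text \<open>Here division by p^m stays inside the space: all coordinates of the vector are divisible
  by p^m, so the quotient lies in the unit ball.\<close>

lemma vcontr_shrink:
  assumes T: "vlinear T" "vcontr T" and \<xi>: "\<xi> \<in> QpN p" "vnear (1 / real p ^ m) \<xi> vzero"
  shows "vnear (1 / real p ^ m) (T \<xi>) vzero"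
proof -
  define \<eta> where "\<eta> i = qp_mult p (qp_const (inverse (of_nat p ^ m))) (\<xi> i)" for i
  have \<eta>Q: "\<eta> i \<in> Qp p" for i using \<xi> by (simp add: \<eta>_def)
  have \<eta>1: "qp_abs p (\<eta> i) \<le> 1" for i
  proof -
    have "qp_abs p (\<eta> i) = real p ^ m * qp_abs p (\<xi> i)"
      using \<xi> by (simp add: \<eta>_def qp_abs_mult padic_abs_inverse padic_abs_p_power)
    also have "\<dots> \<le> real p ^ m * (1 / real p ^ m)"
      using \<xi> p_pos by (intro mult_left_mono) (auto simp: vnear_zero_iff)
    finally show ?thesis using p_pos by simp
  qed
  have \<eta>: "\<eta> \<in> QpN p" using \<eta>Q \<eta>1 by (intro QpNI) (auto simp flip: linorder_not_le)
  have "\<xi> = vsmul p (qp_const (of_nat p ^ m)) \<eta>"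
  proof
    fix i
    show "\<xi> i = vsmul p (qp_const (of_nat p ^ m)) \<eta> i"
      using \<xi> p_pos by (simp add: vsmul_apply \<eta>_def qp_mult_const_const)
  qed
  then have "T \<xi> = vsmul p (qp_const (of_nat p ^ m)) (T \<eta>)"
    using vlinear_smul[OF T(1) qp_const_p_power_in_Zp \<eta>] by simp
  moreover have "vnear 1 (T \<eta>) vzero" using T(2) \<eta> \<eta>1 by (simp add: vcontr_def vnear_zero_iff)
  ultimately show ?thesis using T(1) \<eta> p_pos by (simp add: vsmul_p_power)
qed

text \<open>Finitely supported vectors are dense in the unit ball, and their \<open>p\<^sup>-\<^sup>n\<close>-multiples do lie
  in \<open>\<rat>\<^sub>p(\<nat>)\<close>.\<close>
lemma vcont0_unit_ball_bound:
  assumes T: "vlinear T" "vcont0 T"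
    and b: "\<And>\<xi>. \<xi> \<in> QpN p \<Longrightarrow> vnear (real p ^ n) \<xi> vzero \<Longrightarrow> vnear 1 (T \<xi>) vzero"
    and \<xi>: "\<xi> \<in> QpN p" "vnear 1 \<xi> vzero"
  shows "vnear (1 / real p ^ n) (T \<xi>) vzero"
  unfolding vnear_zero_iff[OF vlinear_in[OF T(1) \<xi>(1)]]
proof
  fix i
  \<comment> \<open>\<open>wnear l\<close> controls only coordinates below \<open>l\<close>, so
    \<open>l\<close> must exceed \<open>i\<close>; being at least \<open>n\<close> makes the bound
    p^-l good enough.\<close>
  define l where "l = max n (Suc i)"
  obtain m where m: "\<forall>z\<in>QpN p. wnear m z vzero \<longrightarrow> wnear l (T z) vzero"
    using T(2) unfolding vcont0_def by blast
  \<comment> \<open>Truncation at \<open>m\<close>: the tail \<open>v\<close> vanishes in the first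
    \<open>m\<close> coordinates and is handled by continuity, while the head \<open>u\<close> has
    finite support, so that p^-n times it (\<open>w\<close> below) still belongs to the
    space.\<close>
  define u where "u j = (if j < m then \<xi> j else qp_const 0)" for j
  define v where "v j = (if j < m then qp_const 0 else \<xi> j)" for j
  have uQ: "u j \<in> Qp p" "v j \<in> Qp p" for j using \<xi> by (auto simp: u_def v_def)
  have uv1: "qp_abs p (u j) \<le> 1" "qp_abs p (v j) \<le> 1" for j
    using \<xi> by (auto simp: u_def v_def vnear_zero_iff)
  have u: "u \<in> QpN p" and v: "v \<in> QpN p"
    using uQ uv1 by (auto intro!: QpNI simp flip: linorder_not_le)
  have \<xi>uv: "\<xi> = vadd p u v"
    by (rule ext) (use \<xi> in \<open>auto simp: vadd_apply u_def v_def qp_add_commute[of "qp_const 0"]\<close>)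
  have "wnear m v vzero"
    using uv1 v by (auto simp: wnear_def vnear_zero_iff vzero_apply v_def)
  then have "wnear l (T v) vzero" using m v by blast
  then have "qp_abs p (T v i) \<le> 1 / real p ^ l"
    using wnearD(2)[of l "T v" vzero i] T(1) v by (simp add: l_def vzero_apply)
  also have "\<dots> \<le> 1 / real p ^ n" by (rule inverse_p_power_antimono) (simp add: l_def)
  finally have Tv: "qp_abs p (T v i) \<le> 1 / real p ^ n" .
  define w where "w j = qp_mult p (qp_const (inverse (of_nat p ^ n))) (u j)" for j
  have wQ: "w j \<in> Qp p" for j using uQ by (simp add: w_def)
  have wabs: "qp_abs p (w j) = real p ^ n * qp_abs p (u j)" for j
    using uQ by (simp add: w_def qp_abs_mult padic_abs_inverse padic_abs_p_power)
  have "{j. qp_abs p (w j) > 1} \<subseteq> {..<m}"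
    using wabs by (auto simp: u_def split: if_splits)
  then have w: "w \<in> QpN p" using wQ by (intro QpNI) (auto intro: finite_subset)
  have "real p ^ n * qp_abs p (u j) \<le> real p ^ n * 1" for j
    using uv1 p_pos by (intro mult_left_mono) auto
  then have "vnear (real p ^ n) w vzero" using w wabs by (simp add: vnear_zero_iff)
  then have Tw: "vnear 1 (T w) vzero" using b w by blast
  have "u = vsmul p (qp_const (of_nat p ^ n)) w"
  proof
    fix j
    show "u j = vsmul p (qp_const (of_nat p ^ n)) w j"
      using uQ p_pos by (simp add: vsmul_apply w_def qp_mult_const_const)
  qed
  then have "T u = vsmul p (qp_const (of_nat p ^ n)) (T w)"
    using vlinear_smul[OF T(1) qp_const_p_power_in_Zp w] by simp
  then have "vnear (1 / real p ^ n) (T u) vzero"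
    using Tw T(1) w p_pos by (simp add: vsmul_p_power)
  then have Tu: "qp_abs p (T u i) \<le> 1 / real p ^ n" using T(1) u by (simp add: vnear_zero_iff)
  have "T \<xi> i = qp_add p (T u i) (T v i)"
    using vlinear_add[OF T(1) u v] by (simp add: \<xi>uv vadd_apply)
  then show "qp_abs p (T \<xi> i) \<le> 1 / real p ^ n"
    using qp_abs_add_le[of "T u i" "T v i"] Tu Tv T(1) u v by simp
qed

lemma vlinear_funpow: "vlinear T \<Longrightarrow> vlinear (T ^^ n)"
proof (induction n)
  case 0
  show ?case by (auto simp: vlinear_def)
next
  case (Suc n)
  then show ?case using vlinear_comp[of T "T ^^ n"] by (simp add: comp_def)
qed

lemma vcont0_funpow: "vlinear T \<Longrightarrow> vcont0 T \<Longrightarrow> vcont0 (T ^^ n)"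
proof (induction n)
  case 0
  show ?case by (auto simp: vcont0_def)
next
  case (Suc n)
  then show ?case using vcont0_comp[of "T ^^ n" T] by (simp add: comp_def vlinear_funpow)
qed

lemma vcontr_comp: "vlinear S \<Longrightarrow> vcontr T \<Longrightarrow> vcontr S \<Longrightarrow> vcontr (\<lambda>\<xi>. T (S \<xi>))"
  by (simp add: vcontr_def)

lemma vcontr_funpow: "vlinear T \<Longrightarrow> vcontr T \<Longrightarrow> vcontr (T ^^ n)"
proof (induction n)
  case 0
  show ?case by (auto simp: vcontr_def)
next
  case (Suc n)
  then show ?case using vcontr_comp[of "T ^^ n" T] by (simp add: comp_def vlinear_funpow)
qed

lemma vneg_zero [simp]: "vneg p vzero = vzero"
  by (rule ext) (simp add: vneg_apply vzero_apply)

lemma vcontr_plus: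
  "vlinear T \<Longrightarrow> vcontr T \<Longrightarrow> vlinear S \<Longrightarrow> vcontr S \<Longrightarrow> vcontr (\<lambda>\<xi>. vadd p (T \<xi>) (S \<xi>))"
  using vnear_add[of _ _ vzero vzero 1] by (simp add: vcontr_def)

lemma vcontr_minus: "vlinear T \<Longrightarrow> vcontr T \<Longrightarrow> vcontr (\<lambda>\<xi>. vneg p (T \<xi>))"
  using vnear_neg[of _ vzero 1] by (simp add: vcontr_def)

lemma vcontr_near:
  assumes T: "vlinear T" "vcontr T" and "\<xi> \<in> QpN p" "\<eta> \<in> QpN p" "vnear 1 \<xi> \<eta>"
  shows "vnear 1 (T \<xi>) (T \<eta>)"
proof -
  have "vnear 1 (T (vadd p \<xi> (vneg p \<eta>))) vzero"
    using assms by (simp add: vcontr_def vnear_diff_iff)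
  then show ?thesis using assms by (simp add: vlinear_diff vnear_diff_iff)
qed

lemma vcontr_near_shrink:
  assumes T: "vlinear T" "vcontr T" and "\<xi> \<in> QpN p" "\<eta> \<in> QpN p" "vnear (1 / real p ^ m) \<xi> \<eta>"
  shows "vnear (1 / real p ^ m) (T \<xi>) (T \<eta>)"
proof -
  have "vnear (1 / real p ^ m) (T (vadd p \<xi> (vneg p \<eta>))) vzero"
    by (rule vcontr_shrink[OF T]) (use assms in \<open>simp_all add: vnear_diff_iff\<close>)
  then show ?thesis using assms by (simp add: vlinear_diff vnear_diff_iff)
qed

lemma vlinear_dist_scale:
  assumes T: "vlinear T" and S: "vlinear S"
    and r: "\<And>\<xi>. \<xi> \<in> QpN p \<Longrightarrow> vnear 1 \<xi> vzero \<Longrightarrow> vnear r (T \<xi>) (S \<xi>)"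
    and \<xi>: "\<xi> \<in> QpN p" "vnear (real p ^ m) \<xi> vzero"
  shows "vnear (r * real p ^ m) (T \<xi>) (S \<xi>)"
proof -
  have "vlinear (\<lambda>\<xi>. vadd p (T \<xi>) (vneg p (S \<xi>)))" using T S vlinear_plus vlinear_minus by blast
  then have "vnear (r * real p ^ m) (vadd p (T \<xi>) (vneg p (S \<xi>))) vzero"
    by (rule vlinear_bound_scale) (use T S r \<xi> in \<open>auto simp: vnear_diff_iff\<close>)
  then show ?thesis using T S \<xi> by (simp add: vnear_diff_iff)
qed

lemma QpN_bounded:
  assumes "\<xi> \<in> QpN p"
  shows "\<exists>l. vnear (real p ^ l) \<xi> vzero"
proof -
  obtain b where b: "\<And>i. qp_abs p (\<xi> i) \<le> b" using bdd_above_qp_abs[OF assms] by (auto simp: bdd_above_def)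
  obtain l where "b < real p ^ l" using real_arch_pow[OF p_gt_1] by blast
  then have "qp_abs p (\<xi> i) \<le> real p ^ l" for i using b[of i] by linarith
  then show ?thesis using assms by (auto simp: vnear_zero_iff)
qed

text \<open>The factor \<open>c\<close> makes room for the size of a vector: estimates on the unit
  ball reach the ball of radius p^l with an extra factor p^l.\<close>

lemma vnear_all_eq:
  assumes "\<xi> \<in> QpN p" "\<eta> \<in> QpN p" and near: "\<And>m. vnear (1 / real p ^ m * c) \<xi> \<eta>"
  shows "\<xi> = \<eta>"
proof
  fix i
  let ?d = "qp_dist p (\<xi> i) (\<eta> i)"
  have d: "?d \<le> 1 / real p ^ m * c" for m using near by (simp add: vnear_def)
  have "?d \<le> 0"
  proof (rule ccontr)
    assume "\<not> ?d \<le> 0"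
    then have pos: "?d > 0" by simp
    have "?d \<le> c" using d[of 0] by simp
    then have "c > 0" using pos by linarith
    then have "?d / c > 0" using pos by simp
    then obtain m where "1 / real p ^ m < ?d / c" using inverse_p_power_less by blast
    then have "1 / real p ^ m * c < ?d" using \<open>c > 0\<close> by (simp add: pos_less_divide_eq)
    then show False using d[of m] by linarith
  qed
  then have "?d = 0" using assms by (intro antisym) (auto simp: qp_dist_nonneg)
  then show "\<xi> i = \<eta> i" using assms by (simp add: qp_dist_eq_0)
qed

end

section \<open>Powers of an idempotent modulo compact operators\<close>

context padic
begin

text \<open>If \<open>k\<close> sends the vector into the unit ball, then a^2 and \<open>a\<close>
  agree there modulo the unit ball. The contraction \<open>a\<close> preserves such congruences, so
  all further powers agree as well.\<close>

lemma funpow_near_if_square_near: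
  assumes a: "vlinear a" "vcontr a" and k: "vlinear k"
    and sq: "\<forall>\<xi>\<in>QpN p. a (a \<xi>) = vadd p (a \<xi>) (k \<xi>)"
    and \<xi>: "\<xi> \<in> QpN p" "vnear 1 (k \<xi>) vzero"
  shows "vnear 1 ((a ^^ Suc j) \<xi>) (a \<xi>)"
proof (induction j)
  case 0
  show ?case using a \<xi> by (simp add: vnear_refl)
next
  case (Suc j)
  have X: "(a ^^ Suc j) \<xi> \<in> QpN p" by (rule vlinear_in[OF vlinear_funpow[OF a(1)] \<xi>(1)])
  have "vnear 1 (a ((a ^^ Suc j) \<xi>)) (a (a \<xi>))"
    by (rule vcontr_near[OF a X _ Suc]) (use a \<xi> in simp)
  moreover have "vnear 1 (a (a \<xi>)) (a \<xi>)"
    using vnear_add[of "a \<xi>" "k \<xi>" "a \<xi>" vzero 1] a k \<xi> by (simp add: sq vnear_refl)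
  ultimately have "vnear 1 (a ((a ^^ Suc j) \<xi>)) (a \<xi>)"
    using vnear_trans[of "a ((a ^^ Suc j) \<xi>)" "a (a \<xi>)" "a \<xi>" 1] a X \<xi> by simp
  then show ?case by simp
qed

lemma vcontr_bound:
  assumes "vlinear T" "vcontr T" "\<xi> \<in> QpN p" "vnear (real p ^ n) \<xi> vzero"
  shows "vnear (real p ^ n) (T \<xi>) vzero"
  using vlinear_bound_scale[of T 1 \<xi> n] assms by (simp add: vcontr_def)

text \<open>The witness is the sum of a^i \<xi> over i < j, which stays in the ball because
  \<open>a\<close> is a contraction and balls are subgroups. Applying the induction hypothesis to
  \<open>a \<xi>\<close> makes it unnecessary to commute \<open>a\<close> with
  \<open>k\<close>.\<close>

lemma funpow_eq_add_range:
  assumes a: "vlinear a" "vcontr a" and k: "vlinear k"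
    and sq: "\<forall>\<xi>\<in>QpN p. a (a \<xi>) = vadd p (a \<xi>) (k \<xi>)"
    and \<xi>: "\<xi> \<in> QpN p" "vnear (real p ^ n) \<xi> vzero"
  shows "\<exists>\<eta>\<in>QpN p. vnear (real p ^ n) \<eta> vzero \<and> (a ^^ Suc j) \<xi> = vadd p (a \<xi>) (k \<eta>)"
  using \<xi>
proof (induction j arbitrary: \<xi>)
  case 0
  then show ?case using a k p_pos by (intro bexI[of _ vzero]) (simp_all add: vnear_refl)
next
  case (Suc j)
  have a\<xi>: "a \<xi> \<in> QpN p" using a Suc.prems by simp
  obtain \<eta> where \<eta>: "\<eta> \<in> QpN p" "vnear (real p ^ n) \<eta> vzero"
      "(a ^^ Suc j) (a \<xi>) = vadd p (a (a \<xi>)) (k \<eta>)"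
    using Suc.IH[OF a\<xi> vcontr_bound[OF a Suc.prems]] by blast
  have "(a ^^ Suc (Suc j)) \<xi> = (a ^^ Suc j) (a \<xi>)" by (simp add: funpow_swap1)
  also have "\<dots> = vadd p (a \<xi>) (k (vadd p \<xi> \<eta>))"
    using \<eta> a k a\<xi> Suc.prems by (simp add: sq vadd_assoc vlinear_add)
  finally have "(a ^^ Suc (Suc j)) \<xi> = vadd p (a \<xi>) (k (vadd p \<xi> \<eta>))" .
  moreover have "vnear (real p ^ n) (vadd p \<xi> \<eta>) vzero"
    using vnear_add[of \<xi> \<eta> vzero vzero] Suc.prems \<eta> by simp
  ultimately show ?case using Suc.prems \<eta> by (intro bexI[of _ "vadd p \<xi> \<eta>"]) simp_all
qed

text \<open>Modulo the unit ball, \<open>k\<close> takes finitely many values on a ball. A power of \<open>a\<close> differs from \<open>a\<close>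
  by a map which factors through \<open>k\<close> and whose range is contained in that of \<open>k\<close>, so only
  finitely many classes of powers are possible.\<close>
lemma funpow_collision:
  assumes a: "vlinear a" "vcontr a" and k: "vlinear k" "vfinrange k"
    and sq: "\<forall>\<xi>\<in>QpN p. a (a \<xi>) = vadd p (a \<xi>) (k \<xi>)"
  shows "\<exists>i j. i < j \<and> (\<forall>\<xi>\<in>QpN p. vnear (real p ^ n) \<xi> vzero \<longrightarrow>
           vnear 1 ((a ^^ Suc i) \<xi>) ((a ^^ Suc j) \<xi>))"
proof -
  let ?B = "\<lambda>\<xi>. \<xi> \<in> QpN p \<and> vnear (real p ^ n) \<xi> vzero"
  have "\<exists>F. finite F \<and> F \<subseteq> QpN p \<and>
     (\<forall>\<xi>\<in>QpN p. vnear (real p ^ n) \<xi> vzero \<longrightarrow> (\<exists>f\<in>F. vnear 1 (k \<xi>) f))"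
    using k(2) unfolding vfinrange_def by (rule spec)
  then obtain F where F: "finite F" "F \<subseteq> QpN p" and Fk: "\<And>\<xi>. ?B \<xi> \<Longrightarrow> \<exists>f\<in>F. vnear 1 (k \<xi>) f"
    by blast
  \<comment> \<open>Only classes that are actually attained by \<open>k\<close> on the ball are
    kept, so that each has a preimage \<open>\<rho> f\<close>.\<close>
  define G where "G = {f \<in> F. \<exists>\<xi>. ?B \<xi> \<and> vnear 1 (k \<xi>) f}"
  have "\<forall>f\<in>G. \<exists>\<xi>. ?B \<xi> \<and> vnear 1 (k \<xi>) f" by (simp add: G_def)
  then obtain \<rho> where \<rho>: "\<And>f. f \<in> G \<Longrightarrow> ?B (\<rho> f)" "\<And>f. f \<in> G \<Longrightarrow> vnear 1 (k (\<rho> f)) f"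
    by metis
  have G: "finite G" "\<And>f. f \<in> G \<Longrightarrow> f \<in> QpN p" using F by (auto simp: G_def)
  \<comment> \<open>At each of the finitely many sample vectors \<open>\<rho> f\<close>, every power
    is described modulo the unit ball by its offset from \<open>a (\<rho> f)\<close>, an element of
    \<open>F\<close>.\<close>
  have "\<exists>g\<in>F. vnear 1 ((a ^^ Suc j) (\<rho> f)) (vadd p (a (\<rho> f)) g)" if f: "f \<in> G" for f j
  proof -
    obtain \<eta> where \<eta>: "?B \<eta>" "(a ^^ Suc j) (\<rho> f) = vadd p (a (\<rho> f)) (k \<eta>)"
      using funpow_eq_add_range[OF a k(1) sq, of "\<rho> f" n j] \<rho>(1)[OF f] by blast
    obtain g where g: "g \<in> F" "vnear 1 (k \<eta>) g" using Fk[OF \<eta>(1)] by blast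
    have "vnear 1 (vadd p (a (\<rho> f)) (k \<eta>)) (vadd p (a (\<rho> f)) g)"
      using a k \<rho>(1)[OF f] \<eta> g F by (intro vnear_add) (auto simp: vnear_refl)
    then show ?thesis using g \<eta> by auto
  qed
  then have "\<forall>j. \<forall>f\<in>G. \<exists>g. g \<in> F \<and> vnear 1 ((a ^^ Suc j) (\<rho> f)) (vadd p (a (\<rho> f)) g)" by blast
  then obtain \<gamma> where \<gamma>: "\<And>j f. f \<in> G \<Longrightarrow> \<gamma> j f \<in> F"
      "\<And>j f. f \<in> G \<Longrightarrow> vnear 1 ((a ^^ Suc j) (\<rho> f)) (vadd p (a (\<rho> f)) (\<gamma> j f))"
    by metis
  \<comment> \<open>Pigeonhole: infinitely many exponents, but only finitely many functions from
    \<open>G\<close> to \<open>F\<close>. Outside \<open>G\<close> the values are arbitrary, hence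
    the restriction.\<close>
  let ?\<Phi> = "\<lambda>j. restrict (\<gamma> j) G"
  have "range ?\<Phi> \<subseteq> G \<rightarrow>\<^sub>E F" using \<gamma>(1) by auto
  moreover have "finite (G \<rightarrow>\<^sub>E F)" using G(1) F(1) by (simp add: finite_PiE)
  ultimately have "finite (range ?\<Phi>)" by (rule finite_subset)
  then have "\<not> inj ?\<Phi>" using finite_imageD infinite_UNIV_nat by blast
  then obtain i j where ij: "i < j" "?\<Phi> i = ?\<Phi> j"
    unfolding inj_def by (metis linorder_neqE_nat)
  have "vnear 1 ((a ^^ Suc i) \<xi>) ((a ^^ Suc j) \<xi>)" if \<xi>: "?B \<xi>" for \<xi>
  proof -
    obtain f where "f \<in> F" "vnear 1 (k \<xi>) f" using Fk[OF \<xi>] by blast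
    then have f: "f \<in> G" "vnear 1 (k \<xi>) f" using \<xi> by (auto simp: G_def)
    have rX: "\<rho> f \<in> QpN p" using \<rho>(1)[OF f(1)] by blast
    have fX: "f \<in> QpN p" using G(2)[OF f(1)] .
    have gX: "\<gamma> i f \<in> QpN p" using \<gamma>(1)[OF f(1)] F by blast
    \<comment> \<open>The vector is the sample vector plus a \<open>\<delta>\<close> that
      \<open>k\<close> sends into the unit ball. On \<open>\<delta>\<close> all positive powers
      agree with \<open>a\<close>, so equal offsets at the sample vector force congruence at the
      given vector.\<close>
    define \<delta> where "\<delta> = vadd p \<xi> (vneg p (\<rho> f))"
    have \<delta>: "\<delta> \<in> QpN p" "\<xi> = vadd p (\<rho> f) \<delta>" using \<xi> rX by (simp_all add: \<delta>_def)
    have "vnear 1 (k \<xi>) (k (\<rho> f))"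
      using vnear_trans[of "k \<xi>" f "k (\<rho> f)" 1] vnear_sym[of "k (\<rho> f)" f 1] f \<rho>(2)[OF f(1)] fX rX \<xi> k(1)
      by simp
    then have k\<delta>: "vnear 1 (k \<delta>) vzero"
      using k(1) \<xi> rX by (simp add: \<delta>_def vlinear_diff vnear_diff_iff)
    have near: "vnear 1 ((a ^^ Suc l) \<xi>) (vadd p (vadd p (a (\<rho> f)) (\<gamma> i f)) (a \<delta>))"
      if l: "\<gamma> l f = \<gamma> i f" for l
    proof -
      have lin: "vlinear (a ^^ Suc l)" using a(1) by (rule vlinear_funpow)
      have "vnear 1 ((a ^^ Suc l) \<delta>) (a \<delta>)"
        by (rule funpow_near_if_square_near[OF a k(1) sq \<delta>(1) k\<delta>])
      moreover have "vnear 1 ((a ^^ Suc l) (\<rho> f)) (vadd p (a (\<rho> f)) (\<gamma> i f))"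
        using \<gamma>(2)[OF f(1), of l] l by simp
      ultimately have "vnear 1 (vadd p ((a ^^ Suc l) (\<rho> f)) ((a ^^ Suc l) \<delta>))
          (vadd p (vadd p (a (\<rho> f)) (\<gamma> i f)) (a \<delta>))"
        using vnear_add[OF vlinear_in[OF lin rX] vlinear_in[OF lin \<delta>(1)]
            vadd_in_QpN[OF vlinear_in[OF a(1) rX] gX] vlinear_in[OF a(1) \<delta>(1)]]
        by blast
      then show ?thesis unfolding \<delta>(2) vlinear_add[OF lin rX \<delta>(1)] .
    qed
    have "\<gamma> j f = \<gamma> i f" using fun_cong[OF ij(2), of f] f(1) by simp
    note near_i = near[OF refl] and near_j = near[OF this]
    have X: "(a ^^ Suc l) \<xi> \<in> QpN p" for l
      using vlinear_in[OF vlinear_funpow[OF a(1)]] \<xi> by blast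
    have Y: "vadd p (vadd p (a (\<rho> f)) (\<gamma> i f)) (a \<delta>) \<in> QpN p" using a(1) rX gX \<delta>(1) by simp
    show ?thesis by (rule vnear_trans[OF X Y X near_i vnear_sym[OF X Y near_j]])
  qed
  then show ?thesis using ij(1) by blast
qed

text \<open>In a finite monogenic semigroup some power is idempotent.\<close>
lemma funpow_eventually_idempotent:
  assumes a: "vlinear a" "vcontr a" and ij: "i < j"
    and near: "\<And>\<xi>. \<xi> \<in> S \<Longrightarrow> vnear 1 ((a ^^ Suc i) \<xi>) ((a ^^ Suc j) \<xi>)" and S: "S \<subseteq> QpN p"
  shows "\<exists>M\<ge>1. \<forall>t\<ge>1. \<forall>\<xi>\<in>S. vnear 1 ((a ^^ (t * M)) \<xi>) ((a ^^ M) \<xi>)"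
proof -
  define d where "d = j - i"
  have d: "d \<ge> 1" "Suc j = Suc i + d" using ij by (auto simp: d_def)
  have X: "(a ^^ l) \<xi> \<in> QpN p" if "\<xi> \<in> S" for l \<xi>
    using vlinear_in[OF vlinear_funpow[OF a(1)]] that S by blast
  \<comment> \<open>Applying further powers of the contraction \<open>a\<close> to the collision
    turns it into a period \<open>d\<close> valid for all exponents from \<open>Suc i\<close>
    on.\<close>
  have step: "vnear 1 ((a ^^ l) \<xi>) ((a ^^ (l + d)) \<xi>)" if \<xi>: "\<xi> \<in> S" and l: "l \<ge> Suc i" for l \<xi>
  proof -
    have "vnear 1 ((a ^^ (l - Suc i)) ((a ^^ Suc i) \<xi>)) ((a ^^ (l - Suc i)) ((a ^^ Suc j) \<xi>))"
      by (rule vcontr_near[OF vlinear_funpow[OF a(1)] vcontr_funpow[OF a] X[OF \<xi>] X[OF \<xi>] near[OF \<xi>]])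
    moreover have "(a ^^ (l - Suc i)) ((a ^^ Suc i) \<xi>) = (a ^^ l) \<xi>"
      using l by (metis comp_apply funpow_add le_add_diff_inverse2)
    moreover have "(a ^^ (l - Suc i)) ((a ^^ Suc j) \<xi>) = (a ^^ (l + d)) \<xi>"
    proof -
      have "(l - Suc i) + Suc j = l + d" using l d(2) by simp
      then show ?thesis by (metis comp_apply funpow_add)
    qed
    ultimately show ?thesis by simp
  qed
  have steps: "vnear 1 ((a ^^ l) \<xi>) ((a ^^ (l + s * d)) \<xi>)" if \<xi>: "\<xi> \<in> S" and l: "l \<ge> Suc i" for l s \<xi>
  proof (induction s)
    case 0
    show ?case using vnear_refl[OF X[OF \<xi>]] by simp
  next
    case (Suc s)
    have "vnear 1 ((a ^^ (l + s * d)) \<xi>) ((a ^^ (l + s * d + d)) \<xi>)" using step[OF \<xi>] l by simp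
    moreover have "l + s * d + d = l + Suc s * d" by simp
    ultimately have "vnear 1 ((a ^^ (l + s * d)) \<xi>) ((a ^^ (l + Suc s * d)) \<xi>)" by (simp only:)
    then show ?case by (rule vnear_trans[OF X[OF \<xi>] X[OF \<xi>] X[OF \<xi>] Suc])
  qed
  \<comment> \<open>A multiple of the period \<open>d\<close> that is past the preperiod
    \<open>Suc i\<close>; every positive multiple of \<open>M\<close> then differs from
    \<open>M\<close> by a multiple of \<open>d\<close>.\<close>
  define M where "M = Suc i * d"
  have M: "M \<ge> 1" "M \<ge> Suc i"
    using d(1) mult_le_mono2[OF d(1), of "Suc i"] by (auto simp: M_def)
  have "vnear 1 ((a ^^ (t * M)) \<xi>) ((a ^^ M) \<xi>)" if t: "t \<ge> 1" and \<xi>: "\<xi> \<in> S" for t \<xi>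
  proof -
    have "t * M = M + ((t - 1) * Suc i) * d"
      using t by (cases t) (simp_all add: M_def algebra_simps)
    then have "vnear 1 ((a ^^ M) \<xi>) ((a ^^ (t * M)) \<xi>)" using steps[OF \<xi> M(2)] by metis
    then show ?thesis by (rule vnear_sym[OF X[OF \<xi>] X[OF \<xi>]])
  qed
  then show ?thesis using M(1) by blast
qed

text \<open>On the ball of radius p^n the difference of the two powers takes values in the unit
  ball. \<open>vcont0_unit_ball_bound\<close> converts this into the bound p^-n on the unit ball;
  continuity of \<open>a\<close> enters here.\<close>

lemma funpow_idempotent_mod:
  assumes a: "vlinear a" "vcont0 a" "vcontr a" and k: "vlinear k" "vfinrange k"
    and sq: "\<forall>\<xi>\<in>QpN p. a (a \<xi>) = vadd p (a \<xi>) (k \<xi>)"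
  shows "\<exists>M\<ge>1. \<forall>t\<ge>1. \<forall>\<xi>\<in>QpN p. vnear 1 \<xi> vzero \<longrightarrow>
           vnear (1 / real p ^ n) ((a ^^ (t * M)) \<xi>) ((a ^^ M) \<xi>)"
proof -
  let ?S = "{\<xi> \<in> QpN p. vnear (real p ^ n) \<xi> vzero}"
  obtain i j where ij: "i < j" "\<And>\<xi>. \<xi> \<in> ?S \<Longrightarrow> vnear 1 ((a ^^ Suc i) \<xi>) ((a ^^ Suc j) \<xi>)"
    using funpow_collision[OF a(1,3) k sq, of n] by blast
  have "\<exists>M\<ge>1. \<forall>t\<ge>1. \<forall>\<xi>\<in>?S. vnear 1 ((a ^^ (t * M)) \<xi>) ((a ^^ M) \<xi>)"
    by (rule funpow_eventually_idempotent[OF a(1,3) ij]) auto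
  then obtain M where M: "M \<ge> 1"
      "\<And>t \<xi>. t \<ge> 1 \<Longrightarrow> \<xi> \<in> ?S \<Longrightarrow> vnear 1 ((a ^^ (t * M)) \<xi>) ((a ^^ M) \<xi>)"
    by blast
  have "vnear (1 / real p ^ n) ((a ^^ (t * M)) \<xi>) ((a ^^ M) \<xi>)"
    if t: "t \<ge> 1" and \<xi>: "\<xi> \<in> QpN p" "vnear 1 \<xi> vzero" for t \<xi>
  proof -
    let ?T = "\<lambda>\<xi>. vadd p ((a ^^ (t * M)) \<xi>) (vneg p ((a ^^ M) \<xi>))"
    note lin = vlinear_funpow[OF a(1)] and con = vcont0_funpow[OF a(1,2)]
    have "vnear (1 / real p ^ n) (?T \<xi>) vzero"
    proof (rule vcont0_unit_ball_bound[OF _ _ _ \<xi>])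
      show "vlinear ?T" by (rule vlinear_plus[OF lin vlinear_minus[OF lin]])
      show "vcont0 ?T" by (rule vcont0_plus[OF lin con vlinear_minus[OF lin] vcont0_minus[OF lin con]])
      show "vnear 1 (?T \<zeta>) vzero" if "\<zeta> \<in> QpN p" "vnear (real p ^ n) \<zeta> vzero" for \<zeta>
        using M(2)[OF t, of \<zeta>] that vlinear_in[OF lin that(1)] by (simp add: vnear_diff_iff)
    qed
    then show ?thesis using vlinear_in[OF lin \<xi>(1)] by (simp add: vnear_diff_iff)
  qed
  then show ?thesis using M(1) by blast
qed

section \<open>Norm limits of operators\<close>

lemma qp_dist_limit_le:
  assumes "x \<in> Qp p" "l \<in> Qp p" "\<And>n. y n \<in> Qp p"
    and "\<And>n. n \<ge> m \<Longrightarrow> qp_dist p (y n) x \<le> c" and lim: "(\<lambda>n. qp_dist p (y n) l) \<longlonglongrightarrow> 0"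
  shows "qp_dist p l x \<le> c"
proof -
  have "(\<lambda>n. qp_dist p (y n) l + c) \<longlonglongrightarrow> 0 + c" by (intro tendsto_add lim tendsto_const)
  moreover have "qp_dist p l x \<le> qp_dist p (y n) l + c" if "n \<ge> m" for n
  proof -
    have "qp_dist p l x \<le> max (qp_dist p l (y n)) (qp_dist p (y n) x)"
      using assms by (intro qp_dist_triangle) auto
    moreover have "qp_dist p l (y n) = qp_dist p (y n) l" using assms by (simp add: qp_dist_commute)
    moreover have "qp_dist p (y n) x \<ge> 0" "qp_dist p (y n) l \<ge> 0" using assms by (simp_all add: qp_dist_nonneg)
    ultimately show ?thesis using assms(4)[OF that] by linarith
  qed
  ultimately show ?thesis by (intro LIMSEQ_le_const[of _ c "qp_dist p l x"]) auto
qed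

lemma vnear_smul:
  assumes "a \<in> Zp p" "\<xi> \<in> QpN p" "\<eta> \<in> QpN p" "vnear r \<xi> \<eta>"
  shows "vnear r (vsmul p a \<xi>) (vsmul p a \<eta>)"
  unfolding vnear_def
proof
  fix i
  have a: "a \<in> Qp p" "qp_abs p a \<le> 1" using assms(1) by (auto simp: Zp_def)
  have "qp_dist p (vsmul p a \<xi> i) (vsmul p a \<eta> i) = qp_abs p a * qp_dist p (\<xi> i) (\<eta> i)"
    using a assms by (simp add: vsmul_apply qp_dist_mult)
  also have "\<dots> \<le> 1 * qp_dist p (\<xi> i) (\<eta> i)"
    using a assms by (intro mult_right_mono) (auto simp: qp_dist_nonneg)
  also have "\<dots> \<le> r" using assms(4) by (simp add: vnear_def)
  finally show "qp_dist p (vsmul p a \<xi> i) (vsmul p a \<eta> i) \<le> r" .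
qed

text \<open>Coordinatewise limits may violate the finiteness condition of \<open>QpN\<close>;
  remaining in one coset of the unit ball preserves it.\<close>

lemma QpN_if_near:
  assumes \<xi>: "\<xi> \<in> QpN p" and \<eta>: "\<And>i. \<eta> i \<in> Qp p" and near: "vnear 1 \<eta> \<xi>"
  shows "\<eta> \<in> QpN p"
proof (rule QpNI[OF \<eta>])
  have "qp_abs p (\<eta> i) \<le> 1" if "qp_abs p (\<xi> i) \<le> 1" for i
    using qp_abs_le_if_dist_le[of "\<eta> i" "\<xi> i" 1] that \<xi> \<eta> near by (simp add: vnear_def)
  then have "{i. qp_abs p (\<eta> i) > 1} \<subseteq> {i. qp_abs p (\<xi> i) > 1}" by (auto simp flip: linorder_not_le)
  then show "finite {i. qp_abs p (\<eta> i) > 1}" using QpN_finite[OF \<xi>] by (rule finite_subset)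
qed

text \<open>At vectors of size p^l the defect of additivity or homogeneity is at most p^(l - m) for
  every m, hence zero. The factor p^l is inevitable: the approximation is uniform on each ball
  only.\<close>

lemma vlinear_if_approx:
  assumes e: "\<And>\<xi>. \<xi> \<in> QpN p \<Longrightarrow> e \<xi> \<in> QpN p" and T: "\<And>n. vlinear (T n)"
    and near: "\<And>\<xi> l m. \<xi> \<in> QpN p \<Longrightarrow> vnear (real p ^ l) \<xi> vzero \<Longrightarrow>
      vnear (1 / real p ^ m * real p ^ l) (e \<xi>) (T m \<xi>)"
  shows "vlinear e"
  unfolding vlinear_def
proof (intro conjI ballI)
  show "e \<in> QpN p \<rightarrow> QpN p" using e by blast
next
  fix \<xi> \<eta> assume \<xi>: "\<xi> \<in> QpN p" and \<eta>: "\<eta> \<in> QpN p"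
  obtain l1 l2 where l12: "vnear (real p ^ l1) \<xi> vzero" "vnear (real p ^ l2) \<eta> vzero"
    using QpN_bounded \<xi> \<eta> by metis
  define l where "l = max l1 l2"
  have "real p ^ l1 \<le> real p ^ l" "real p ^ l2 \<le> real p ^ l"
    using p_gt_1 by (auto simp: l_def intro!: power_increasing)
  then have l: "vnear (real p ^ l) \<xi> vzero" "vnear (real p ^ l) \<eta> vzero"
    using l12 by (auto elim: vnear_mono)
  then have ls: "vnear (real p ^ l) (vadd p \<xi> \<eta>) vzero"
    using vnear_add[of \<xi> \<eta> vzero vzero] \<xi> \<eta> by simp
  show "e (vadd p \<xi> \<eta>) = vadd p (e \<xi>) (e \<eta>)"
  proof (rule vnear_all_eq)
    fix m
    let ?r = "1 / real p ^ m * real p ^ l"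
    have X: "e (vadd p \<xi> \<eta>) \<in> QpN p" "T m (vadd p \<xi> \<eta>) \<in> QpN p" "vadd p (e \<xi>) (e \<eta>) \<in> QpN p"
      using e T \<xi> \<eta> by simp_all
    have "vnear ?r (vadd p (e \<xi>) (e \<eta>)) (vadd p (T m \<xi>) (T m \<eta>))"
      by (rule vnear_add) (use e T \<xi> \<eta> near l in auto)
    then have "vnear ?r (vadd p (e \<xi>) (e \<eta>)) (T m (vadd p \<xi> \<eta>))"
      by (simp only: vlinear_add[OF T \<xi> \<eta>])
    then have "vnear ?r (T m (vadd p \<xi> \<eta>)) (vadd p (e \<xi>) (e \<eta>))"
      by (rule vnear_sym[OF X(3,2)])
    with near[OF vadd_in_QpN[OF \<xi> \<eta>] ls]
    show "vnear ?r (e (vadd p \<xi> \<eta>)) (vadd p (e \<xi>) (e \<eta>))"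
      by (rule vnear_trans[OF X])
  qed (use e \<xi> \<eta> in simp_all)
next
  fix a \<xi> assume a: "a \<in> Zp p" and \<xi>: "\<xi> \<in> QpN p"
  obtain l where l: "vnear (real p ^ l) \<xi> vzero" using QpN_bounded[OF \<xi>] by blast
  have "vsmul p a vzero = vzero"
    using a by (intro ext) (simp add: vsmul_apply vzero_apply Zp_in_Qp)
  then have ls: "vnear (real p ^ l) (vsmul p a \<xi>) vzero"
    using vnear_smul[OF a \<xi> vzero_in_QpN l] by simp
  show "e (vsmul p a \<xi>) = vsmul p a (e \<xi>)"
  proof (rule vnear_all_eq)
    fix m
    let ?r = "1 / real p ^ m * real p ^ l"
    have X: "e (vsmul p a \<xi>) \<in> QpN p" "T m (vsmul p a \<xi>) \<in> QpN p" "vsmul p a (e \<xi>) \<in> QpN p"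
      using e T \<xi> a by simp_all
    have "vnear ?r (vsmul p a (e \<xi>)) (vsmul p a (T m \<xi>))"
      by (rule vnear_smul) (use a e T \<xi> near l in auto)
    then have "vnear ?r (vsmul p a (e \<xi>)) (T m (vsmul p a \<xi>))"
      by (simp only: vlinear_smul[OF T a \<xi>])
    then have "vnear ?r (T m (vsmul p a \<xi>)) (vsmul p a (e \<xi>))"
      by (rule vnear_sym[OF X(3,2)])
    with near[OF vsmul_in_QpN[OF a \<xi>] ls]
    show "vnear ?r (e (vsmul p a \<xi>)) (vsmul p a (e \<xi>))"
      by (rule vnear_trans[OF X])
  qed (use e \<xi> a in simp_all)
qed

text \<open>Completeness of Q_p is applied to each coordinate at each vector. The rate p^(l - m) on
  the ball of radius p^l is inherited by the limit, because non-strict distance bounds are closed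
  under limits.\<close>

lemma operator_limit:
  assumes T: "\<And>n. vlinear (T n)" "\<And>n. vcont0 (T n)" "\<And>n. vcontr (T n)"
    and cau: "\<And>m n \<xi>. m \<le> n \<Longrightarrow> \<xi> \<in> QpN p \<Longrightarrow> vnear 1 \<xi> vzero \<Longrightarrow>
      vnear (1 / real p ^ m) (T n \<xi>) (T m \<xi>)"
  obtains e where "vlinear e" "vcont0 e" "vcontr e"
    "\<And>\<xi> l m. \<xi> \<in> QpN p \<Longrightarrow> vnear (real p ^ l) \<xi> vzero \<Longrightarrow>
      vnear (1 / real p ^ m * real p ^ l) (e \<xi>) (T m \<xi>)"
proof -
  have cau': "qp_dist p (T n \<xi> i) (T m \<xi> i) \<le> 1 / real p ^ m * real p ^ l"
    if "m \<le> n" "\<xi> \<in> QpN p" "vnear (real p ^ l) \<xi> vzero" for m n l \<xi> i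
    using vlinear_dist_scale[OF T(1)[of n] T(1)[of m] cau[OF that(1)] that(2,3)] by (simp add: vnear_def)
  have "\<exists>x. x \<in> Qp p \<and> (\<lambda>n. qp_dist p (T n \<xi> i) x) \<longlonglongrightarrow> 0" if \<xi>: "\<xi> \<in> QpN p" for \<xi> i
  proof -
    obtain l where l: "vnear (real p ^ l) \<xi> vzero" using QpN_bounded[OF \<xi>] by blast
    have X: "T n \<xi> i \<in> Qp p" for n using T(1) \<xi> by simp
    have "\<exists>N. \<forall>m\<ge>N. \<forall>n\<ge>N. qp_dist p (T m \<xi> i) (T n \<xi> i) < \<epsilon>" if "\<epsilon> > 0" for \<epsilon>
    proof -
      have "\<epsilon> / real p ^ l > 0" using that p_pos by simp
      then obtain N where "1 / real p ^ N < \<epsilon> / real p ^ l" by (rule inverse_p_power_less)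
      then have N: "1 / real p ^ N * real p ^ l < \<epsilon>" using p_pos by (simp add: pos_less_divide_eq)
      have "qp_dist p (T m \<xi> i) (T n \<xi> i) < \<epsilon>" if "m \<ge> N" "n \<ge> N" for m n
      proof -
        have "qp_dist p (T m \<xi> i) (T n \<xi> i) \<le> 1 / real p ^ N * real p ^ l"
        proof (rule qp_dist_triangle_le[of _ "T N \<xi> i"])
          show "qp_dist p (T m \<xi> i) (T N \<xi> i) \<le> 1 / real p ^ N * real p ^ l"
            by (rule cau'[OF that(1) \<xi> l])
          show "qp_dist p (T N \<xi> i) (T n \<xi> i) \<le> 1 / real p ^ N * real p ^ l"
            using cau'[OF that(2) \<xi> l, of i] qp_dist_commute[OF X[of N] X[of n]] by simp
        qed (rule X)+
        then show ?thesis using N by linarith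
      qed
      then show ?thesis by blast
    qed
    then obtain x where "x \<in> Qp p" "(\<lambda>n. qp_dist p (T n \<xi> i) x) \<longlonglongrightarrow> 0"
      using qp_complete[of "\<lambda>n. T n \<xi> i", OF X] by blast
    then show ?thesis by blast
  qed
  then have "\<forall>\<xi> i. \<exists>x. \<xi> \<in> QpN p \<longrightarrow> x \<in> Qp p \<and> (\<lambda>n. qp_dist p (T n \<xi> i) x) \<longlonglongrightarrow> 0" by blast
  then obtain e where eQ: "\<And>\<xi> i. \<xi> \<in> QpN p \<Longrightarrow> e \<xi> i \<in> Qp p"
    and lim: "\<And>\<xi> i. \<xi> \<in> QpN p \<Longrightarrow> (\<lambda>n. qp_dist p (T n \<xi> i) (e \<xi> i)) \<longlonglongrightarrow> 0"
    by metis
  have near: "vnear (1 / real p ^ m * real p ^ l) (e \<xi>) (T m \<xi>)"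
    if \<xi>: "\<xi> \<in> QpN p" "vnear (real p ^ l) \<xi> vzero" for \<xi> l m
    unfolding vnear_def
  proof
    fix i
    show "qp_dist p (e \<xi> i) (T m \<xi> i) \<le> 1 / real p ^ m * real p ^ l"
    proof (rule qp_dist_limit_le[OF _ eQ[OF \<xi>(1)] _ _ lim[OF \<xi>(1)]])
      show "qp_dist p (T n \<xi> i) (T m \<xi> i) \<le> 1 / real p ^ m * real p ^ l" if "n \<ge> m" for n
        by (rule cau'[OF that \<xi>])
    qed (use T(1) \<xi> in simp_all)
  qed
  have eX: "e \<xi> \<in> QpN p" if \<xi>: "\<xi> \<in> QpN p" for \<xi>
  proof -
    obtain l where l: "vnear (real p ^ l) \<xi> vzero" using QpN_bounded[OF \<xi>] by blast
    \<comment> \<open>Taking the index equal to \<open>l\<close> makes the error exactly 1, so the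
      limit lies in the coset of a genuine vector.\<close>
    have "vnear 1 (e \<xi>) (T l \<xi>)" using near[OF \<xi> l, of l] p_pos by simp
    then show ?thesis by (rule QpN_if_near[OF vlinear_in[OF T(1) \<xi>] eQ[OF \<xi>]])
  qed
  have near1: "vnear (1 / real p ^ m) (e \<xi>) (T m \<xi>)" if "\<xi> \<in> QpN p" "vnear 1 \<xi> vzero" for \<xi> m
    using near[of \<xi> 0 m] that by simp
  have "vlinear e" using vlinear_if_approx[of e T] eX T(1) near by blast
  moreover have "vcontr e"
    unfolding vcontr_def
  proof (intro ballI impI)
    fix \<xi> assume \<xi>: "\<xi> \<in> QpN p" "vnear 1 \<xi> vzero"
    have "vnear 1 (e \<xi>) (T 0 \<xi>)" using near1[OF \<xi>, of 0] by simp
    moreover have "vnear 1 (T 0 \<xi>) vzero" using T(3)[of 0] \<xi> by (simp add: vcontr_def)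
    ultimately show "vnear 1 (e \<xi>) vzero"
      by (rule vnear_trans[OF eX[OF \<xi>(1)] vlinear_in[OF T(1) \<xi>(1)] vzero_in_QpN])
  qed
  moreover have "vcont0 e"
    unfolding vcont0_def
  proof
    fix n
    obtain m where m: "\<forall>z\<in>QpN p. wnear m z vzero \<longrightarrow> wnear n (T n z) vzero"
      using T(2)[of n] unfolding vcont0_def by blast
    have "wnear n (e z) vzero" if z: "z \<in> QpN p" "wnear m z vzero" for z
    proof -
      \<comment> \<open>\<open>wnear m\<close> forces \<open>z\<close> into the unit ball, where the
        error of \<open>T n\<close> is at most p^-n; the modulus of continuity of \<open>T n\<close>
        therefore serves for \<open>e\<close>.\<close>
      have "wnear n (e z) (T n z)" using near1[OF z(1) wnearD(1)[OF z(2)]] by (rule vnear_imp_wnear)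
      moreover have "wnear n (T n z) vzero" using m z by blast
      ultimately show ?thesis
        by (rule wnear_trans[OF eX[OF z(1)] vlinear_in[OF T(1) z(1)] vzero_in_QpN])
    qed
    then show "\<exists>m. \<forall>z\<in>QpN p. wnear m z vzero \<longrightarrow> wnear n (e z) vzero" by blast
  qed
  ultimately show ?thesis using that near by blast
qed

section \<open>Contractions, compact contractions and their cosets\<close>

lemma restrict_in_B1:
  assumes "vlinear T" "vcont0 T" "vcontr T"
  shows "restrict T (QpN p) \<in> B1 p"
  using restrict_in_Bop[OF assms(1,2)] assms(3) by (simp add: B1_iff Bop_iff vcontr_def)

lemma op_add_apply: "\<xi> \<in> QpN p \<Longrightarrow> op_add p T S \<xi> = vadd p (T \<xi>) (S \<xi>)"
  by (simp add: op_add_def)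

lemma op_neg_apply: "\<xi> \<in> QpN p \<Longrightarrow> op_neg p T \<xi> = vneg p (T \<xi>)"
  by (simp add: op_neg_def)

lemma B1_op_add: "T \<in> B1 p \<Longrightarrow> S \<in> B1 p \<Longrightarrow> op_add p T S \<in> B1 p"
  unfolding op_add_def
  by (rule restrict_in_B1) (simp_all add: B1_iff vlinear_plus vcont0_plus vcontr_plus)

lemma B1_op_neg: "T \<in> B1 p \<Longrightarrow> op_neg p T \<in> B1 p"
  unfolding op_neg_def
  by (rule restrict_in_B1) (simp_all add: B1_iff vlinear_minus vcont0_minus vcontr_minus)

lemma vfinrangeD:
  assumes "vfinrange T"
  obtains F where "finite F" "F \<subseteq> QpN p"
    "\<forall>\<xi>\<in>QpN p. vnear (real p ^ n) \<xi> vzero \<longrightarrow> (\<exists>f\<in>F. vnear 1 (T \<xi>) f)"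
  using assms unfolding vfinrange_def by meson

lemma K1_op_add:
  assumes T: "T \<in> K1 p" and S: "S \<in> K1 p"
  shows "op_add p T S \<in> K1 p"
proof -
  have B: "T \<in> B1 p" "S \<in> B1 p" using T S by (auto simp: K1_iff)
  then have lin: "vlinear T" "vlinear S" by (auto simp: B1_iff)
  have "vfinrange (op_add p T S)"
    unfolding vfinrange_def
  proof
    fix n
    have "vfinrange T" "vfinrange S" using T S by (auto simp: K1_iff)
    obtain F where F: "finite F" "F \<subseteq> QpN p"
      "\<forall>\<xi>\<in>QpN p. vnear (real p ^ n) \<xi> vzero \<longrightarrow> (\<exists>f\<in>F. vnear 1 (T \<xi>) f)"
      using \<open>vfinrange T\<close> by (rule vfinrangeD)
    obtain G where G: "finite G" "G \<subseteq> QpN p"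
      "\<forall>\<xi>\<in>QpN p. vnear (real p ^ n) \<xi> vzero \<longrightarrow> (\<exists>f\<in>G. vnear 1 (S \<xi>) f)"
      using \<open>vfinrange S\<close> by (rule vfinrangeD)
    let ?H = "(\<lambda>(f, g). vadd p f g) ` (F \<times> G)"
    have "\<exists>h\<in>?H. vnear 1 (op_add p T S \<xi>) h" if \<xi>: "\<xi> \<in> QpN p" "vnear (real p ^ n) \<xi> vzero" for \<xi>
    proof -
      obtain f where f: "f \<in> F" "vnear 1 (T \<xi>) f" using F(3) \<xi> by blast
      obtain g where g: "g \<in> G" "vnear 1 (S \<xi>) g" using G(3) \<xi> by blast
      have "f \<in> QpN p" "g \<in> QpN p" using F(2) G(2) f g by auto
      then have "vnear 1 (op_add p T S \<xi>) (vadd p f g)"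
        using f g lin \<xi> vnear_add by (simp add: op_add_apply)
      then show ?thesis using f g by blast
    qed
    moreover have "finite ?H" using F(1) G(1) by simp
    moreover have "?H \<subseteq> QpN p" using F(2) G(2) by (auto intro!: vadd_in_QpN)
    ultimately show "\<exists>F. finite F \<and> F \<subseteq> QpN p \<and>
        (\<forall>\<xi>\<in>QpN p. vnear (real p ^ n) \<xi> vzero \<longrightarrow> (\<exists>f\<in>F. vnear 1 (op_add p T S \<xi>) f))"
      by blast
  qed
  then show ?thesis using B1_op_add[OF B] by (simp add: K1_iff)
qed

lemma K1_op_neg:
  assumes T: "T \<in> K1 p"
  shows "op_neg p T \<in> K1 p"
proof -
  have B: "T \<in> B1 p" and fin: "vfinrange T" using T by (auto simp: K1_iff)
  then have lin: "vlinear T" by (auto simp: B1_iff)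
  have "vfinrange (op_neg p T)"
    unfolding vfinrange_def
  proof
    fix n
    obtain F where F: "finite F" "F \<subseteq> QpN p"
      "\<forall>\<xi>\<in>QpN p. vnear (real p ^ n) \<xi> vzero \<longrightarrow> (\<exists>f\<in>F. vnear 1 (T \<xi>) f)"
      using fin by (rule vfinrangeD)
    have "\<exists>h\<in>vneg p ` F. vnear 1 (op_neg p T \<xi>) h" if \<xi>: "\<xi> \<in> QpN p" "vnear (real p ^ n) \<xi> vzero" for \<xi>
    proof -
      obtain f where f: "f \<in> F" "vnear 1 (T \<xi>) f" using F(3) \<xi> by blast
      have "f \<in> QpN p" using F(2) f by auto
      then have "vnear 1 (op_neg p T \<xi>) (vneg p f)"
        using f lin \<xi> by (simp add: op_neg_apply vnear_neg)
      then show ?thesis using f by blast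
    qed
    moreover have "finite (vneg p ` F)" using F(1) by simp
    moreover have "vneg p ` F \<subseteq> QpN p" using F(2) by auto
    ultimately show "\<exists>F. finite F \<and> F \<subseteq> QpN p \<and>
        (\<forall>\<xi>\<in>QpN p. vnear (real p ^ n) \<xi> vzero \<longrightarrow> (\<exists>f\<in>F. vnear 1 (op_neg p T \<xi>) f))"
      by blast
  qed
  then show ?thesis using B1_op_neg[OF B] by (simp add: K1_iff)
qed

lemma K1_zero: "restrict (\<lambda>\<xi>. vzero) (QpN p) \<in> K1 p"
proof -
  have z: "vsmul p a vzero = vzero" if "a \<in> Zp p" for a
    using that by (intro ext) (simp add: vsmul_apply vzero_apply Zp_in_Qp)
  have "restrict (\<lambda>\<xi>. vzero) (QpN p) \<in> B1 p"
    by (rule restrict_in_B1) (simp_all add: vlinear_def vcont0_def vcontr_def wnear_refl vnear_refl z)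
  moreover have "vfinrange (restrict (\<lambda>\<xi>. vzero) (QpN p))"
    unfolding vfinrange_def by (intro allI exI[of _ "{vzero}"]) (simp add: vnear_refl)
  ultimately show ?thesis by (simp add: K1_iff)
qed

text \<open>\<open>op_norm\<close> is a real supremum, so its lower bound also rests on boundedness
  of the values. Both inequalities are needed to squeeze a sequence of norms to zero.\<close>

lemma op_norm_le:
  assumes "\<And>\<xi>. \<xi> \<in> QpN p \<Longrightarrow> T \<xi> \<in> QpN p"
    and "\<And>\<xi>. \<xi> \<in> QpN p \<Longrightarrow> vnear 1 \<xi> vzero \<Longrightarrow> vnear r (T \<xi>) vzero"
  shows "0 \<le> op_norm p T" "op_norm p T \<le> r"
proof -
  let ?B = "{\<xi> \<in> QpN p. vnorm p \<xi> \<le> 1}"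
  have z: "vzero \<in> ?B" by (simp add: vnorm_le_iff vnear_refl)
  have le: "vnorm p (T \<xi>) \<le> r" if "\<xi> \<in> ?B" for \<xi>
  proof -
    have \<xi>: "\<xi> \<in> QpN p" "vnear 1 \<xi> vzero" using that vnorm_le_iff[of \<xi> 1] by auto
    show ?thesis using assms(2)[OF \<xi>] vnorm_le_iff[OF assms(1)[OF \<xi>(1)]] by blast
  qed
  show "op_norm p T \<le> r"
    unfolding op_norm_def by (rule cSUP_least[OF _ le]) (use z in blast)+
  have bdd: "bdd_above ((\<lambda>\<xi>. vnorm p (T \<xi>)) ` ?B)" using le by (auto simp: bdd_above_def)
  have "0 \<le> qp_abs p (T vzero 0)" using assms(1) by (simp add: qp_abs_nonneg)
  also have "\<dots> \<le> vnorm p (T vzero)"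
    unfolding vnorm_def using bdd_above_qp_abs[OF assms(1)[OF vzero_in_QpN]] by (intro cSUP_upper) auto
  also have "\<dots> \<le> op_norm p T"
    unfolding op_norm_def by (rule cSUP_upper[OF z bdd])
  finally show "0 \<le> op_norm p T" .
qed

text \<open>With k = e - a one has e + x = a + (k + x) and a + x = e + (-k + x); \<open>K1 p\<close>
  is closed under sums and negatives.\<close>

lemma op_coset_eq_if_diff:
  assumes a: "a \<in> B1 p" and e: "e \<in> B1 p" and d: "op_add p e (op_neg p a) \<in> K1 p"
  shows "op_coset p e (K1 p) = op_coset p a (K1 p)"
proof -
  define k where "k = op_add p e (op_neg p a)"
  have k: "k \<in> K1 p" using d by (simp add: k_def)
  have lin: "vlinear T" if "T \<in> B1 p \<or> T \<in> K1 p" for T using that by (auto simp: K1_iff B1_iff)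
  have e_eq: "e \<xi> = vadd p (a \<xi>) (k \<xi>)" if "\<xi> \<in> QpN p" for \<xi>
    using that lin a e by (simp add: k_def op_add_apply op_neg_apply)
  have 1: "op_add p e x = op_add p a (op_add p k x)" if "x \<in> K1 p" for x
    unfolding op_add_def[of p e x] op_add_def[of p a "op_add p k x"]
  proof (rule restrict_ext)
    fix \<xi> assume \<xi>: "\<xi> \<in> QpN p"
    have "a \<xi> \<in> QpN p" "k \<xi> \<in> QpN p" "x \<xi> \<in> QpN p" using lin a k that \<xi> by simp_all
    then show "vadd p (e \<xi>) (x \<xi>) = vadd p (a \<xi>) (op_add p k x \<xi>)"
      using \<xi> by (simp add: e_eq op_add_apply vadd_assoc)
  qed
  have 2: "op_add p a x = op_add p e (op_add p (op_neg p k) x)" if "x \<in> K1 p" for x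
    unfolding op_add_def[of p a x] op_add_def[of p e "op_add p (op_neg p k) x"]
  proof (rule restrict_ext)
    fix \<xi> assume \<xi>: "\<xi> \<in> QpN p"
    have X: "a \<xi> \<in> QpN p" "k \<xi> \<in> QpN p" "x \<xi> \<in> QpN p" using lin a k that \<xi> by simp_all
    have "vadd p (k \<xi>) (vadd p (vneg p (k \<xi>)) (x \<xi>)) = vadd p (vadd p (k \<xi>) (vneg p (k \<xi>))) (x \<xi>)"
      using X by (simp only: vadd_assoc vneg_in_QpN)
    also have "\<dots> = x \<xi>" using X by (simp add: vadd_commute[of vzero])
    finally show "vadd p (a \<xi>) (x \<xi>) = vadd p (e \<xi>) (op_add p (op_neg p k) x \<xi>)"
      using \<xi> X by (simp add: e_eq op_add_apply op_neg_apply vadd_assoc)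
  qed
  show ?thesis
  proof (intro equalityI subsetI)
    fix y assume "y \<in> op_coset p e (K1 p)"
    then obtain x where x: "x \<in> K1 p" "y = op_add p e x" by (auto simp: op_coset_def)
    then show "y \<in> op_coset p a (K1 p)"
      using 1[OF x(1)] K1_op_add[OF k x(1)] by (auto simp: op_coset_def)
  next
    fix y assume "y \<in> op_coset p a (K1 p)"
    then obtain x where x: "x \<in> K1 p" "y = op_add p a x" by (auto simp: op_coset_def)
    then show "y \<in> op_coset p e (K1 p)"
      using 2[OF x(1)] K1_op_add[OF K1_op_neg[OF k] x(1)] by (auto simp: op_coset_def)
  qed
qed

section \<open>Construction of the idempotent\<close>

lemma restrict_funpow_in_subalgebra:
  assumes A: "norm_closed_subalgebra p A" and a: "a \<in> A" and n: "n \<ge> 1"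
  shows "restrict (a ^^ n) (QpN p) \<in> A"
  using n
\<comment> \<open>The induction starts at 1 because the identity need not belong to
  \<open>A\<close>.\<close>
proof (induction n rule: nat_induct_at_least)
  case base
  have "a \<in> extensional (QpN p)" using A a by (auto simp: norm_closed_subalgebra_def B1_iff)
  then show ?case using a by (simp add: extensional_restrict)
next
  case (Suc n)
  have "restrict (a ^^ Suc n) (QpN p) = op_comp p a (restrict (a ^^ n) (QpN p))"
    unfolding op_comp_def compose_def by (rule restrict_ext) simp
  moreover have "op_comp p a (restrict (a ^^ n) (QpN p)) \<in> A"
  proof -
    have "\<forall>T\<in>A. \<forall>S\<in>A. op_comp p T S \<in> A"
      using A unfolding norm_closed_subalgebra_def by (elim conjE)
    then show ?thesis using a Suc.IH by blast
  qed
  ultimately show ?case by (simp only:)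
qed

lemma idempotent_mod_K1_lift:
  assumes A: "norm_closed_subalgebra p A" and a: "a \<in> A" and k: "k \<in> K1 p"
    and sq: "op_comp p a a = op_add p a k"
  shows "\<exists>e\<in>A. op_comp p e e = e \<and> op_add p e (op_neg p a) \<in> K1 p"
proof -
  have aB: "a \<in> B1 p" using A a by (auto simp: norm_closed_subalgebra_def)
  then have a': "vlinear a" "vcont0 a" "vcontr a" by (auto simp: B1_iff)
  have k': "vlinear k" "vfinrange k" using k by (auto simp: K1_iff B1_iff)
  have sq': "\<forall>\<xi>\<in>QpN p. a (a \<xi>) = vadd p (a \<xi>) (k \<xi>)"
  proof
    fix \<xi> assume "\<xi> \<in> QpN p"
    then show "a (a \<xi>) = vadd p (a \<xi>) (k \<xi>)"
      using fun_cong[OF sq, of \<xi>] by (simp add: op_comp_def compose_def op_add_apply)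
  qed
  have "\<forall>n. \<exists>M\<ge>1. \<forall>t\<ge>1. \<forall>\<xi>\<in>QpN p. vnear 1 \<xi> vzero \<longrightarrow>
      vnear (1 / real p ^ n) ((a ^^ (t * M)) \<xi>) ((a ^^ M) \<xi>)"
    using funpow_idempotent_mod[OF a' k' sq'] by blast
  then obtain M where "\<forall>n. M n \<ge> 1 \<and> (\<forall>t\<ge>1. \<forall>\<xi>\<in>QpN p. vnear 1 \<xi> vzero \<longrightarrow>
      vnear (1 / real p ^ n) ((a ^^ (t * M n)) \<xi>) ((a ^^ M n) \<xi>))"
    by (rule choice[THEN exE])
  then have M1: "\<And>n. M n \<ge> 1" and M: "\<And>n t \<xi>. t \<ge> 1 \<Longrightarrow> \<xi> \<in> QpN p \<Longrightarrow> vnear 1 \<xi> vzero \<Longrightarrow>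
      vnear (1 / real p ^ n) ((a ^^ (t * M n)) \<xi>) ((a ^^ M n) \<xi>)"
    by blast+
  \<comment> \<open>The exponents for different moduli are unrelated. The product makes every
    \<open>M m\<close> with m <= n divide \<open>N n\<close>, so the powers become
    compatible.\<close>
  define N where "N n = (\<Prod>m\<le>n. M m)" for n
  have N1: "N n \<ge> 1" for n unfolding N_def using M1 by (intro prod_ge_1) simp
  have N_dvd: "M m dvd N n" if "m \<le> n" for m n unfolding N_def using that by (intro dvd_prodI) auto
  note lin = vlinear_funpow[OF a'(1)] and con = vcont0_funpow[OF a'(1,2)] and ctr = vcontr_funpow[OF a'(1,3)]
  \<comment> \<open>Every power whose exponent is a positive multiple of \<open>M m\<close> agrees
    with a^(M m) modulo p^m. This gives both the Cauchy property and the idempotency of the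
    limit.\<close>
  have multiples: "vnear (1 / real p ^ m) ((a ^^ u) \<xi>) ((a ^^ v) \<xi>)"
    if "u \<ge> 1" "v \<ge> 1" "M m dvd u" "M m dvd v" and \<xi>: "\<xi> \<in> QpN p" "vnear 1 \<xi> vzero" for m u v \<xi>
  proof -
    have near: "vnear (1 / real p ^ m) ((a ^^ w) \<xi>) ((a ^^ M m) \<xi>)" if "w \<ge> 1" "M m dvd w" for w
    proof -
      obtain t where t: "w = t * M m" using \<open>M m dvd w\<close> by (metis dvd_div_mult_self)
      then have "t \<ge> 1" using \<open>w \<ge> 1\<close> by (cases t) auto
      then show ?thesis using M[OF _ \<xi>] t by simp
    qed
    have X: "(a ^^ w) \<xi> \<in> QpN p" for w by (rule vlinear_in[OF lin \<xi>(1)])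
    show ?thesis by (rule vnear_trans[OF X X X near vnear_sym[OF X X near]]) (use that in simp_all)
  qed
  obtain e where e: "vlinear e" "vcont0 e" "vcontr e"
    and near: "\<And>\<xi> l m. \<xi> \<in> QpN p \<Longrightarrow> vnear (real p ^ l) \<xi> vzero \<Longrightarrow>
      vnear (1 / real p ^ m * real p ^ l) (e \<xi>) ((a ^^ N m) \<xi>)"
  proof (rule operator_limit[of "\<lambda>n. a ^^ N n"])
    show "vnear (1 / real p ^ m) ((a ^^ N n) \<xi>) ((a ^^ N m) \<xi>)"
      if "m \<le> n" "\<xi> \<in> QpN p" "vnear 1 \<xi> vzero" for m n \<xi>
      using that N1 N_dvd by (intro multiples) auto
  qed (use lin con ctr in auto)
  have near1: "vnear (1 / real p ^ m) (e \<xi>) ((a ^^ N m) \<xi>)"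
    if "\<xi> \<in> QpN p" "vnear 1 \<xi> vzero" for \<xi> m
    using near[of \<xi> 0 m] that by simp
  define e' where "e' = restrict e (QpN p)"
  have e'B: "e' \<in> B1 p" unfolding e'_def by (rule restrict_in_B1[OF e])
  have "e' \<in> A"
  proof -
    define Tn where "Tn n = restrict (a ^^ N n) (QpN p)" for n
    have Tn: "Tn n \<in> A" for n
      unfolding Tn_def by (rule restrict_funpow_in_subalgebra[OF A a N1])
    have bound: "0 \<le> op_norm p (op_add p (Tn n) (op_neg p e'))"
        "op_norm p (op_add p (Tn n) (op_neg p e')) \<le> 1 / real p ^ n" for n
    proof -
      have D: "op_add p (Tn n) (op_neg p e') \<xi> = vadd p ((a ^^ N n) \<xi>) (vneg p (e \<xi>))" if "\<xi> \<in> QpN p" for \<xi>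
        using that by (simp add: op_add_apply op_neg_apply Tn_def e'_def)
      have X: "(a ^^ N n) \<xi> \<in> QpN p" "e \<xi> \<in> QpN p" if "\<xi> \<in> QpN p" for \<xi>
        using vlinear_in[OF lin that] vlinear_in[OF e(1) that] by auto
      have 1: "op_add p (Tn n) (op_neg p e') \<xi> \<in> QpN p" if "\<xi> \<in> QpN p" for \<xi>
        using D[OF that] X[OF that] by simp
      have 2: "vnear (1 / real p ^ n) (op_add p (Tn n) (op_neg p e') \<xi>) vzero"
        if "\<xi> \<in> QpN p" "vnear 1 \<xi> vzero" for \<xi>
        using D[OF that(1)] X[OF that(1)] near1[OF that, of n] by (simp add: vnear_diff_iff vnear_sym)
      show "0 \<le> op_norm p (op_add p (Tn n) (op_neg p e'))"
        "op_norm p (op_add p (Tn n) (op_neg p e')) \<le> 1 / real p ^ n"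
        using op_norm_le[of "op_add p (Tn n) (op_neg p e')", OF 1 2] by simp_all
    qed
    have "(\<lambda>n. (1 / real p) ^ n) \<longlonglongrightarrow> 0" using p_gt_1 by (intro LIMSEQ_realpow_zero) auto
    then have "(\<lambda>n. 1 / real p ^ n) \<longlonglongrightarrow> 0" by (simp add: power_divide)
    then have "(\<lambda>n. op_norm p (op_add p (Tn n) (op_neg p e'))) \<longlonglongrightarrow> 0"
      by (rule Lim_null_comparison[rotated]) (use bound in simp)
    then show ?thesis using A e'B Tn unfolding norm_closed_subalgebra_def by blast
  qed
  moreover have "op_comp p e' e' = e'"
  proof -
    \<comment> \<open>Equality is put as distance 0, the form in which
      \<open>vlinear_dist_scale\<close> extends it from the unit ball to balls of any radius
      p^l.\<close>
    have unit: "vnear 0 (e (e \<xi>)) (e \<xi>)" if \<xi>: "\<xi> \<in> QpN p" "vnear 1 \<xi> vzero" for \<xi>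
    proof -
      have X: "e \<xi> \<in> QpN p" "e (e \<xi>) \<in> QpN p" using e(1) \<xi> by simp_all
      have P: "(a ^^ w) \<xi> \<in> QpN p" for w by (rule vlinear_in[OF lin \<xi>(1)])
      have e\<xi>: "vnear 1 (e \<xi>) vzero" using e(3) \<xi> by (simp add: vcontr_def)
      have "e (e \<xi>) = e \<xi>"
      proof (rule vnear_all_eq[OF X(2,1), of 1])
        fix m
        let ?r = "1 / real p ^ m" and ?T = "a ^^ N m"
        have TT: "?T (?T \<xi>) = (a ^^ (N m + N m)) \<xi>" by (simp add: funpow_add)
        have "vnear ?r (e (e \<xi>)) (?T (e \<xi>))" by (rule near1[OF X(1) e\<xi>])
        moreover have "vnear ?r (?T (e \<xi>)) (?T (?T \<xi>))"
          by (rule vcontr_near_shrink[OF lin ctr X(1) P near1[OF \<xi>]])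
        ultimately have 1: "vnear ?r (e (e \<xi>)) (?T (?T \<xi>))"
          by (rule vnear_trans[OF X(2) vlinear_in[OF lin X(1)] vlinear_in[OF lin P]])
        \<comment> \<open>Idempotency modulo p^m: the exponents 2 N_m and N_m are both positive
          multiples of \<open>M m\<close>.\<close>
        have "vnear ?r (?T (?T \<xi>)) (?T \<xi>)"
          unfolding TT using N1[of m] N_dvd[of m m] \<xi> by (intro multiples) auto
        then have "vnear ?r (e (e \<xi>)) (?T \<xi>)"
          by (rule vnear_trans[OF X(2) vlinear_in[OF lin P] P 1])
        then have "vnear ?r (e (e \<xi>)) (e \<xi>)"
          by (rule vnear_trans[OF X(2) P X(1) _ vnear_sym[OF X(1) P near1[OF \<xi>]]])
        then show "vnear (1 / real p ^ m * 1) (e (e \<xi>)) (e \<xi>)" by simp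
      qed
      then show ?thesis using X vnear_refl[of "e \<xi>" 0] by simp
    qed
    have ee: "e (e \<xi>) = e \<xi>" if \<xi>: "\<xi> \<in> QpN p" for \<xi>
    proof -
      obtain l where l: "vnear (real p ^ l) \<xi> vzero" using QpN_bounded[OF \<xi>] by blast
      have "vnear (0 * real p ^ l) (e (e \<xi>)) (e \<xi>)"
        by (rule vlinear_dist_scale[OF vlinear_comp[OF e(1) e(1)] e(1) unit \<xi> l])
      then show ?thesis using vnear_all_eq[of "e (e \<xi>)" "e \<xi>" 0] e(1) \<xi> by simp
    qed
    show ?thesis
      unfolding op_comp_def compose_def e'_def
      by (rule restrict_ext) (use ee vlinear_in[OF e(1)] in simp)
  qed
  moreover have "op_add p e' (op_neg p a) \<in> K1 p"
  proof -
    have "vfinrange (op_add p e' (op_neg p a))"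
      unfolding vfinrange_def
    proof
      fix n
      obtain F where F: "finite F" "F \<subseteq> QpN p"
        "\<forall>\<xi>\<in>QpN p. vnear (real p ^ n) \<xi> vzero \<longrightarrow> (\<exists>f\<in>F. vnear 1 (k \<xi>) f)"
        using k'(2) by (rule vfinrangeD)
      have "\<exists>f\<in>F. vnear 1 (op_add p e' (op_neg p a) \<xi>) f"
        if \<xi>: "\<xi> \<in> QpN p" "vnear (real p ^ n) \<xi> vzero" for \<xi>
      proof -
        obtain j where j: "N n = Suc j" using N1[of n] by (cases "N n") auto
        obtain \<eta> where \<eta>: "\<eta> \<in> QpN p" "vnear (real p ^ n) \<eta> vzero"
            "(a ^^ N n) \<xi> = vadd p (a \<xi>) (k \<eta>)"
          using funpow_eq_add_range[OF a'(1,3) k'(1) sq' \<xi>, of j] unfolding j by blast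
        obtain f where f: "f \<in> F" "vnear 1 (k \<eta>) f" using F(3) \<eta> by blast
        have X: "a \<xi> \<in> QpN p" "e \<xi> \<in> QpN p" "k \<eta> \<in> QpN p" "f \<in> QpN p"
          using a'(1) e(1) k'(1) \<xi>(1) \<eta>(1) f(1) F(2) by auto
        \<comment> \<open>On the ball of radius p^n the power with exponent \<open>N n\<close>
          approximates \<open>e\<close> with error p^-n p^n = 1. Modulo the unit ball e - a thus
          takes the value \<open>k \<eta>\<close> with \<open>\<eta>\<close> in the same ball, and
          the finite set for \<open>k\<close> also serves for e - a.\<close>
        have "vnear 1 (e \<xi>) (vadd p (a \<xi>) (k \<eta>))" using near[OF \<xi>, of n] \<eta>(3) p_pos by simp
        then have "vnear 1 (vadd p (e \<xi>) (vneg p (a \<xi>))) (vadd p (vadd p (a \<xi>) (k \<eta>)) (vneg p (a \<xi>)))"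
          using X by (intro vnear_add) (simp_all add: vnear_refl)
        then have "vnear 1 (vadd p (e \<xi>) (vneg p (a \<xi>))) (k \<eta>)" using X by simp
        then have "vnear 1 (vadd p (e \<xi>) (vneg p (a \<xi>))) f"
          using vnear_trans[of "vadd p (e \<xi>) (vneg p (a \<xi>))" "k \<eta>" f 1] X f(2) by simp
        then show ?thesis using f \<xi> by (auto simp: op_add_apply op_neg_apply e'_def)
      qed
      then show "\<exists>F. finite F \<and> F \<subseteq> QpN p \<and>
          (\<forall>\<xi>\<in>QpN p. vnear (real p ^ n) \<xi> vzero \<longrightarrow> (\<exists>f\<in>F. vnear 1 (op_add p e' (op_neg p a) \<xi>) f))"
        using F(1,2) by blast
    qed
    then show ?thesis using B1_op_add[OF e'B B1_op_neg[OF aB]] by (simp add: K1_iff)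
  qed
  ultimately show ?thesis by blast
qed

end

theorem theorem3p17:
  fixes p :: nat and A :: "(qpN \<Rightarrow> qpN) set" and E :: "(qpN \<Rightarrow> qpN) set"
  assumes "prime p"
    and "norm_closed_subalgebra p A"
    and "K1 p \<subseteq> A"
    and "a \<in> A" and "E = op_coset p a (K1 p)"
    and "op_coset p (op_comp p a a) (K1 p) = E"
  shows "\<exists>e\<in>A. op_comp p e e = e \<and> op_coset p e (K1 p) = E"
proof -
  interpret padic p by unfold_locales (rule assms(1))
  have AB: "A \<subseteq> B1 p" using assms(2) by (simp add: norm_closed_subalgebra_def)
  have "op_comp p a a \<in> A" using assms(2,4) by (simp add: norm_closed_subalgebra_def)
  then have aa: "vlinear (op_comp p a a)" "op_comp p a a \<in> extensional (QpN p)"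
    using AB by (auto simp: B1_iff)
  \<comment> \<open>Adding the zero operator, which is compact, puts a^2 into its own coset. That
    coset equals \<open>E\<close>, the coset of \<open>a\<close>, so a^2 = a + k for some compact
    \<open>k\<close>.\<close>
  have "op_add p (op_comp p a a) (restrict (\<lambda>\<xi>. vzero) (QpN p)) = op_comp p a a"
    by (rule extensionalityI[of _ "QpN p"])
       (use aa in \<open>auto simp: op_add_def\<close>)
  then have "op_comp p a a \<in> op_coset p (op_comp p a a) (K1 p)"
    using K1_zero unfolding op_coset_def by (metis (mono_tags, lifting) mem_Collect_eq)
  then obtain k where k: "k \<in> K1 p" "op_comp p a a = op_add p a k"
    using assms(5,6) by (auto simp: op_coset_def)
  obtain e where "e \<in> A" "op_comp p e e = e" "op_add p e (op_neg p a) \<in> K1 p"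
    using idempotent_mod_K1_lift[OF assms(2,4) k] by blast
  moreover have "op_coset p e (K1 p) = op_coset p a (K1 p)"
    using op_coset_eq_if_diff[of a e] AB assms(4) calculation by blast
  ultimately show ?thesis using assms(5) by blast
qed

end
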